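(* Let $r\in\mathbb R$, let $h\in\mathfrak F^{\mathrm x,\mathrm y,I}$ be a maximizer of the permuton energy $\mathfrak E$ over $\mathfrak F^{\mathrm x,\mathrm y,I}$, and let $g=-h_{xy}$ be the density of the corresponding permuton. Take $0<x_1<x_2<1$ and $0<y_1<y_2<1$ such that the four points $(x_1,y_1)$, $(x_1,y_2)$, $(x_2,y_2)$, $(x_2,y_1)$ are strictly inside $\Omega^{\mathrm x,\mathrm y,I}$ and $g(x,y)$ is continuous and positive at these points. Then $$\ln\left(\frac{g(x_1,y_1)\,g(x_2,y_2)}{g(x_1,y_2)\,g(x_2,y_1)}\right)-2r\int_{y_1}^{y_2}\int_{x_1}^{x_2}g(x,y)\,dx\,dy=0.$$
   Context: Data: positive integers $k,\ell$, reals $0=\mathrm x_0<\mathrm x_1<\dots<\mathrm x_k=1$ and $0=\mathrm y_0<\mathrm y_1<\dots<\mathrm y_\ell=1$, and a $0/1$ array $I=[I_{uv}]_{1\le u\le k,1\le v\le\ell}$ ($u$ indexes the horizontal and $v$ the vertical direction; $I$ is not assumed convex). The data are assumed non-degenerate: there is a non-negative real array $[B_{uv}]$ with $B_{uv}>0$ if and only if $I_{uv}=1$, $\sum_v B_{uv}=\mathrm x_u-\mathrm x_{u-1}$ for all $u$, and $\sum_u B_{uv}=\mathrm y_v-\mathrm y_{v-1}$ for all $v$. $\mathfrak F$ is the class of real functions $h(x,y)$, $0\le x,y\le1$, which are $1$-Lipschitz in each variable, satisfy $h(x_1,y_1)+h(x_2,y_2)-h(x_1,y_2)-h(x_2,y_1)\le0$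 for all $0\le x_1<x_2\le1$, $0\le y_1<y_2\le1$, and satisfy $h(x,0)=0$, $h(x,1)=1-x$, $h(0,y)=y$, $h(1,y)=0$. A permuton is a probability measure on $[0,1]^2$ with uniform marginals; $h(x,y)=\mu([x,1]\times[0,y])$ is a bijection between $\mathfrak F$ and permutons $\mu$. $\mathfrak F^{\mathrm x,\mathrm y,I}$ is the set of $h\in\mathfrak F$ with $h(\mathrm x_u,\mathrm y_v)+h(\mathrm x_{u-1},\mathrm y_{v-1})-h(\mathrm x_u,\mathrm y_{v-1})-h(\mathrm x_{u-1},\mathrm y_v)=0$ whenever $I_{uv}=0$ (the permuton gives zero mass to that rectangle). Permuton energy: $\mathfrak E(h)=\int_0^1\int_0^1[h_{xy}\ln(-h_{xy})-r h_xh_y]\,dx\,dy$, where the first term means $-\int\int\mu(x,y)\ln\mu(x,y)\,dx\,dy$ if the permuton $\mu$ of $h$ has a Lebesgue density $\mu(x,y)=-h_{xy}$ (with $0\ln0=0$); $\mathfrak E(h)=-\infty$ if $\mu$ is not absolutely continuous or the integral equals $-\infty$. A point $(x,y)$ with $0<x,y<1$ is strictly inside $\Omega^{\mathrm x,\mathrm y,I}$ if $\mathrm x_{u-1}<x<\mathrm x_u$ and $\mathrm y_{v-1}<y<\mathrm y_v$ for some $(u,v)$ with $I_{uv}=1$. *)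

theory Defs
  imports "HOL-Probability.Probability"
begin

definition nondegenerate ::
  "nat \<Rightarrow> nat \<Rightarrow> (nat \<Rightarrow> real) \<Rightarrow> (nat \<Rightarrow> real) \<Rightarrow> (nat \<Rightarrow> nat \<Rightarrow> nat) \<Rightarrow> bool" where
  "nondegenerate k l xs ys I \<longleftrightarrow>
     (\<exists>B :: nat \<Rightarrow> nat \<Rightarrow> real.
        (\<forall>u\<in>{1..k}. \<forall>v\<in>{1..l}. 0 \<le> B u v \<and> (0 < B u v \<longleftrightarrow> I u v = 1)) \<and>
        (\<forall>u\<in>{1..k}. (\<Sum>v=1..l. B u v) = xs u - xs (u - 1)) \<and>
        (\<forall>v\<in>{1..l}. (\<Sum>u=1..k. B u v) = ys v - ys (v - 1)))"

text \<open>
  Functions on the closed unit square are represented by curried functions on all pairs of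
  reals; only their values on the square are constrained or used.
\<close>

definition class_F :: "(real \<Rightarrow> real \<Rightarrow> real) set" where
  "class_F = {h.
     (\<forall>y\<in>{0..1}. 1-lipschitz_on {0..1} (\<lambda>x. h x y)) \<and>
     (\<forall>x\<in>{0..1}. 1-lipschitz_on {0..1} (\<lambda>y. h x y)) \<and>
     (\<forall>x1 x2 y1 y2. 0 \<le> x1 \<and> x1 < x2 \<and> x2 \<le> 1 \<and> 0 \<le> y1 \<and> y1 < y2 \<and> y2 \<le> 1 \<longrightarrow>
        h x1 y1 + h x2 y2 - h x1 y2 - h x2 y1 \<le> 0) \<and>
     (\<forall>x\<in>{0..1}. h x 0 = 0 \<and> h x 1 = 1 - x) \<and>
     (\<forall>y\<in>{0..1}. h 0 y = y \<and> h 1 y = 0)}"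

definition class_F_xyI ::
  "nat \<Rightarrow> nat \<Rightarrow> (nat \<Rightarrow> real) \<Rightarrow> (nat \<Rightarrow> real) \<Rightarrow> (nat \<Rightarrow> nat \<Rightarrow> nat) \<Rightarrow>
   (real \<Rightarrow> real \<Rightarrow> real) set" where
  "class_F_xyI k l xs ys I = {h \<in> class_F.
     \<forall>u\<in>{1..k}. \<forall>v\<in>{1..l}. I u v = 0 \<longrightarrow>
       h (xs u) (ys v) + h (xs (u - 1)) (ys (v - 1))
         - h (xs u) (ys (v - 1)) - h (xs (u - 1)) (ys v) = 0}"

text \<open>
  Permutons are Borel measures on the whole plane; uniform marginals force them to be
  concentrated on the closed unit square.
\<close>

definition permuton :: "(real \<times> real) measure \<Rightarrow> bool" where
  "permuton \<mu> \<longleftrightarrow> prob_space \<mu> \<and> sets \<mu> = sets borel \<and>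
     distr \<mu> borel fst = uniform_measure lborel {0..1} \<and>
     distr \<mu> borel snd = uniform_measure lborel {0..1}"

definition permuton_of :: "(real \<Rightarrow> real \<Rightarrow> real) \<Rightarrow> (real \<times> real) measure \<Rightarrow> bool" where
  "permuton_of h \<mu> \<longleftrightarrow> permuton \<mu> \<and>
     (\<forall>x\<in>{0..1}. \<forall>y\<in>{0..1}. h x y = measure \<mu> ({x..1} \<times> {0..y}))"

definition permuton_density :: "(real \<times> real) measure \<Rightarrow> real \<times> real \<Rightarrow> real" where
  "permuton_density \<mu> p = enn2real (RN_deriv lborel \<mu> p)"

text \<open>
  The open square is used as domain of integration because \<^const>\<open>deriv\<close> at a boundary
  point would depend on values of a function outside the closed square.
\<close>

abbreviation unit_square :: "(real \<times> real) set" where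
  "unit_square \<equiv> {0<..<1} \<times> {0<..<1}"

text \<open>
  A measure related to \<^term>\<open>h\<close> by \<^const>\<open>permuton_of\<close> is unique, so the definite description
  below denotes it. Since \<open>t ln t\<close> is bounded below on \<open>[0, \<infinity>)\<close> (with \<open>0 ln 0 = 0\<close>, as in HOL)
  and the product of the partial derivatives is bounded almost everywhere, the energy integral
  either converges or equals \<open>-\<infinity>\<close>, the latter exactly when the entropy term is not integrable.
\<close>

definition permuton_energy :: "real \<Rightarrow> (real \<Rightarrow> real \<Rightarrow> real) \<Rightarrow> ereal" where
  "permuton_energy r h =
     (if \<exists>\<mu>. permuton_of h \<mu> \<and> absolutely_continuous lborel \<mu> then
        (let g = permuton_density (THE \<mu>. permuton_of h \<mu>) in
           if set_integrable lebesgue unit_square (\<lambda>p. g p * ln (g p)) then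
             ereal (LINT p:unit_square|lebesgue.
               - g p * ln (g p)
               - r * deriv (\<lambda>s. h s (snd p)) (fst p) * deriv (\<lambda>t. h (fst p) t) (snd p))
           else - \<infinity>)
      else - \<infinity>)"

definition strictly_inside ::
  "nat \<Rightarrow> nat \<Rightarrow> (nat \<Rightarrow> real) \<Rightarrow> (nat \<Rightarrow> real) \<Rightarrow> (nat \<Rightarrow> nat \<Rightarrow> nat) \<Rightarrow> real \<Rightarrow> real \<Rightarrow> bool" where
  "strictly_inside k l xs ys I x y \<longleftrightarrow> 0 < x \<and> x < 1 \<and> 0 < y \<and> y < 1 \<and>
     (\<exists>u\<in>{1..k}. \<exists>v\<in>{1..l}. I u v = 1 \<and>
        xs (u - 1) < x \<and> x < xs u \<and> ys (v - 1) < y \<and> y < ys v)"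

end

theory Submission
  imports Defs
begin

text \<open>
  Let \<open>f\<close> be the density of the permuton \<open>\<mu>\<close> of \<open>h\<close>. Almost everywhere the partial derivatives of
  \<open>h\<close> are \<open>h\<^sub>x(x,y) = - \<integral>\<^sub>0\<^sup>y f(x,t) dt\<close> and \<open>h\<^sub>y(x,y) = \<integral>\<^sub>x\<^sup>1 f(s,y) ds\<close>, and Fubini turns
  \<open>- \<integral>\<integral> h\<^sub>x h\<^sub>y\<close> into the probability \<open>c(f,f)\<close> that, of two independent points drawn from \<open>\<mu>\<close>, the
  second lies to the north-east of the first. So the energy is the functional
  \<open>r c(f,f) - \<integral> f ln f\<close> of the density alone, a bilinear form plus the entropy
  (lemma \<open>permuton_energy_eq_concordance\<close>); from there on no derivative of \<open>h\<close> occurs.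

  Perturb \<open>f\<close> to \<open>f + d \<phi>\<close>, where \<open>\<phi>\<close> is bounded, has vanishing marginals, lives where \<open>f\<close> is
  between two positive constants and does not charge the forbidden rectangles. For small \<open>\<bar>d\<bar>\<close> this
  is the density of another competitor, so the coefficient of \<open>d\<close> in the energy vanishes
  (lemma \<open>first_order_condition\<close>):
  \<open>\<integral> \<phi> (ln f - r w) = 0\<close>, where \<open>w(x,y) = 1 - x + y - 2 h(x,y)\<close> is the sum of the \<open>\<mu>\<close>-masses of the
  two quadrants to the north-east and to the south-west of \<open>(x,y)\<close>.

  Now let \<open>\<phi>\<close> be \<open>+1\<close> on small squares of side \<open>e\<close> at \<open>(x\<^sub>1,y\<^sub>1)\<close> and \<open>(x\<^sub>2,y\<^sub>2)\<close>, and \<open>-1\<close> on such squares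
  at the other two corners. The function \<open>V = ln g - r w\<close> is continuous at the corners and agrees with
  \<open>ln f - r w\<close> almost everywhere on the squares. Dividing by \<open>e\<^sup>2\<close> and letting \<open>e\<close> tend to \<open>0\<close>
  leaves \<open>V(x\<^sub>1,y\<^sub>1) + V(x\<^sub>2,y\<^sub>2) - V(x\<^sub>1,y\<^sub>2) - V(x\<^sub>2,y\<^sub>1) = 0\<close>. The terms of \<open>w\<close> that depend on one variable
  only cancel, and the alternating sum of \<open>- 2 h\<close> is twice the \<open>\<mu>\<close>-mass of the rectangle spanned by the
  corners, which is the assertion.

  Two points need real work. First, the derivatives of \<open>h\<close> must be computed almost everywhere; this
  is Lebesgue's differentiation theorem in one dimension, proved here from the Henstock lemma and
  the Vitali covering theorem. Second, if the maximal energy were \<open>- \<infinity>\<close>, maximality would carry no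
  information; non-degeneracy excludes this, because the density equal to \<open>B\<^sub>u\<^sub>v\<close> divided by the area on each
  grid cell is a competitor of finite energy (lemma \<open>nondegenerate_imp_finite_energy\<close>).
\<close>

section \<open>Lebesgue differentiation in one dimension\<close>

text \<open>
  For a gauge \<open>\<gamma>\<close> belonging to \<open>e c\<close>, intervals that are \<open>\<gamma>\<close>-fine, disjoint and violate the
  estimate by the factor \<open>c\<close> have total length at most \<open>e\<close>, by the Henstock lemma. The violating
  intervals form a Vitali cover of the bad set, so the bad set is covered, up to a null set, by a
  disjoint family of this kind. The tag \<open>x\<close> need not be the midpoint of its interval; this freedom
  yields one-sided difference quotients below.
\<close>

lemma negligible_bad_difference_quotient:
  fixes G :: "real \<Rightarrow> real"
  assumes G: "G integrable_on {a..b}" and c: "0 < c"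
  shows "negligible {x \<in> {a<..<b}. \<forall>d>0. \<exists>m \<rho>. 0 < \<rho> \<and> \<rho> < d \<and> x \<in> cball m \<rho> \<and> cball m \<rho> \<subseteq> {a..b} \<and>
            c * (2 * \<rho>) < \<bar>2 * \<rho> * G x - integral (cball m \<rho>) G\<bar>}" (is "negligible ?S")
  unfolding negligible_outer_le
proof (intro allI impI)
  fix e :: real assume e: "0 < e"
  obtain \<gamma> where \<gamma>: "gauge \<gamma>"
    and hen: "\<And>p. p tagged_partial_division_of (cbox a b) \<Longrightarrow> \<gamma> fine p \<Longrightarrow>
       (\<Sum>(x,k)\<in>p. norm (measure lborel k *\<^sub>R G x - integral k G)) < e * c"
    by (rule Henstock_lemma[of G a b "e * c"]) (use G c e in auto)
  define K where "K = {(m, \<rho>, x). 0 < \<rho> \<and> x \<in> cball m \<rho> \<and> cball m \<rho> \<subseteq> {a..b} \<and> cball m \<rho> \<subseteq> \<gamma> x \<and>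
            c * (2 * \<rho>) < \<bar>2 * \<rho> * G x - integral (cball m \<rho>) G\<bar>}"
  define m where "m = (\<lambda>i::real \<times> real \<times> real. fst i)"
  define \<rho> where "\<rho> = (\<lambda>i::real \<times> real \<times> real. fst (snd i))"
  define t where "t = (\<lambda>i::real \<times> real \<times> real. snd (snd i))"
  define B where "B = (\<lambda>i. cball (m i) (\<rho> i))"
  have KD: "0 < \<rho> i" "t i \<in> B i" "B i \<subseteq> {a..b}" "B i \<subseteq> \<gamma> (t i)"
    "c * (2 * \<rho> i) < \<bar>2 * \<rho> i * G (t i) - integral (B i) G\<bar>" if "i \<in> K" for i
    using that by (auto simp: K_def m_def \<rho>_def t_def B_def)
  have vit: "\<exists>i. i \<in> K \<and> x \<in> cball (m i) (\<rho> i) \<and> \<rho> i < d" if x: "x \<in> ?S" and d: "0 < d" for x d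
  proof -
    obtain d' where d': "d' > 0" "ball x d' \<subseteq> \<gamma> x"
      using \<gamma> by (meson gauge_def openE)
    have "0 < min d (d'/2)" using d d' by auto
    with x obtain n s where ns: "0 < s" "s < min d (d'/2)" "x \<in> cball n s" "cball n s \<subseteq> {a..b}"
      "c * (2 * s) < \<bar>2 * s * G x - integral (cball n s) G\<bar>"
      unfolding mem_Collect_eq by blast
    have "cball n s \<subseteq> ball x d'"
    proof
      fix z assume "z \<in> cball n s"
      then show "z \<in> ball x d'" using ns(2,3) by (auto simp: dist_real_def)
    qed
    with ns d' have "(n, s, x) \<in> K" by (auto simp: K_def)
    then show ?thesis using ns by (intro exI[of _ "(n,s,x)"]) (auto simp: m_def \<rho>_def)
  qed
  obtain C where C: "countable C" "C \<subseteq> K"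
    "pairwise (\<lambda>i j. disjnt (cball (m i) (\<rho> i)) (cball (m j) (\<rho> j))) C"
    "negligible (?S - (\<Union>i\<in>C. cball (m i) (\<rho> i)))"
    by (rule Vitali_covering_theorem_cballs[of K \<rho> ?S m]) (use KD vit in auto)
  have Bcbox: "B i = {m i - \<rho> i..m i + \<rho> i}" for i
    by (simp add: B_def cball_eq_atLeastAtMost)
  have cont: "measure lborel (B i) = 2 * \<rho> i" if "i \<in> K" for i
    using KD(1)[OF that] unfolding Bcbox by simp
  have fin: "measure lebesgue (\<Union>i\<in>C'. B i) \<le> e" if C': "C' \<subseteq> C" "finite C'" for C'
  proof -
    have inj: "inj_on (\<lambda>i. (t i, B i)) C'"
    proof (rule inj_onI)
      fix i j assume ij: "i \<in> C'" "j \<in> C'" "(t i, B i) = (t j, B j)"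
      show "i = j"
      proof (rule ccontr)
        assume "i \<noteq> j"
        then have "disjnt (B i) (B j)"
          using C(3) C'(1) ij(1,2) unfolding pairwise_def B_def by blast
        moreover have "t i \<in> B i" using KD(2) C(2) C' ij by blast
        ultimately show False using ij by (auto simp: disjnt_def)
      qed
    qed
    define p where "p = (\<lambda>i. (t i, B i)) ` C'"
    have "p tagged_partial_division_of (cbox a b)"
      unfolding tagged_partial_division_of_def
    proof (intro conjI allI impI)
      show "finite p" using C' by (simp add: p_def)
      fix x k assume "(x, k) \<in> p"
      then obtain i where i: "i \<in> C'" "x = t i" "k = B i" by (auto simp: p_def)
      then have iK: "i \<in> K" using C C' by blast
      show "x \<in> k" "k \<subseteq> cbox a b" using KD[OF iK] i by auto
      show "\<exists>a b. k = cbox a b" using i Bcbox by auto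
    next
      fix x1 K1 x2 K2 assume *: "(x1, K1) \<in> p \<and> (x2, K2) \<in> p \<and> (x1, K1) \<noteq> (x2, K2)"
      then obtain i j where ij: "i \<in> C'" "j \<in> C'" "K1 = B i" "K2 = B j" "i \<noteq> j"
        unfolding p_def by blast
      then have "disjnt (B i) (B j)" using C(3) C'(1) unfolding pairwise_def B_def by blast
      then show "interior K1 \<inter> interior K2 = {}"
        using ij interior_subset[of K1] interior_subset[of K2] unfolding disjnt_def by blast
    qed
    moreover have "\<gamma> fine p"
    proof (rule fineI)
      fix x k assume "(x, k) \<in> p"
      then obtain i where i: "i \<in> C'" "x = t i" "k = B i" unfolding p_def by blast
      then show "k \<subseteq> \<gamma> x" using KD(4)[of i] C C' by blast
    qed
    ultimately have "(\<Sum>(x,k)\<in>p. norm (measure lborel k *\<^sub>R G x - integral k G)) < e * c" by (rule hen)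
    moreover have "(\<Sum>(x,k)\<in>p. norm (measure lborel k *\<^sub>R G x - integral k G))
        = (\<Sum>i\<in>C'. \<bar>measure lborel (B i) * G (t i) - integral (B i) G\<bar>)"
      unfolding p_def by (subst sum.reindex[OF inj]) simp
    moreover have "(\<Sum>i\<in>C'. c * measure lborel (B i)) \<le> (\<Sum>i\<in>C'. \<bar>measure lborel (B i) * G (t i) - integral (B i) G\<bar>)"
    proof (rule sum_mono)
      fix i assume "i \<in> C'"
      then have iK: "i \<in> K" using C C' by blast
      show "c * measure lborel (B i) \<le> \<bar>measure lborel (B i) * G (t i) - integral (B i) G\<bar>"
        using KD(5)[OF iK] cont[OF iK] by simp
    qed
    ultimately have "c * (\<Sum>i\<in>C'. measure lborel (B i)) < e * c" by (simp add: sum_distrib_left)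
    then have "(\<Sum>i\<in>C'. measure lborel (B i)) < e" using c by (simp add: mult.commute)
    moreover have "measure lebesgue (\<Union>i\<in>C'. B i) \<le> (\<Sum>i\<in>C'. measure lebesgue (B i))"
      by (rule measure_UNION_le) (use C' in \<open>auto simp: Bcbox\<close>)
    ultimately show ?thesis by (simp add: Bcbox)
  qed
  have meas: "B i \<in> lmeasurable" for i by (simp add: Bcbox)
  define T where "T = (?S - (\<Union>i\<in>C. B i)) \<union> (\<Union>i\<in>C. B i)"
  have U: "(\<Union>i\<in>C. B i) \<in> lmeasurable" "measure lebesgue (\<Union>i\<in>C. B i) \<le> e"
    by (rule fmeasurable_UN_bound[OF C(1) meas fin], assumption+)
      (rule measure_UN_bound[OF C(1) meas fin])
  have N: "?S - (\<Union>i\<in>C. B i) \<in> null_sets lebesgue"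
    using C(4) by (simp add: negligible_iff_null_sets B_def)
  then have N': "?S - (\<Union>i\<in>C. B i) \<in> lmeasurable"
    by (auto simp: null_sets_def fmeasurable_def)
  have "measure lebesgue T \<le> measure lebesgue (?S - (\<Union>i\<in>C. B i)) + measure lebesgue (\<Union>i\<in>C. B i)"
    unfolding T_def using N' U by (intro measure_Un_le) auto
  also have "\<dots> \<le> e" using U N by (simp add: null_sets_def measure_def)
  finally have "measure lebesgue T \<le> e" .
  moreover have "T \<in> lmeasurable" unfolding T_def using N' U(1) by (rule fmeasurable.Un)
  moreover have "?S \<subseteq> T" by (auto simp: T_def)
  ultimately show "\<exists>T. ?S \<subseteq> T \<and> T \<in> lmeasurable \<and> measure lebesgue T \<le> e" by blast
qed

text \<open>
  Outside the countably many null sets given by \<open>c = 1 / (k + 1)\<close> and the intervals \<open>(- n, n)\<close>, all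
  difference quotients over short intervals with endpoint \<open>x\<close> are within \<open>c\<close> of \<open>G x\<close>.
\<close>

theorem AE_has_real_derivative_integral:
  fixes G :: "real \<Rightarrow> real"
  assumes G: "integrable lborel G"
  shows "AE x in lborel. ((\<lambda>s. LINT u|lborel. G u * indicator {..s} u) has_real_derivative G x) (at x)"
proof -
  define F where "F s = (LINT u|lborel. G u * indicator {..s} u)" for s
  have int: "integrable lborel (\<lambda>u. G u * indicator S u)" if "S \<in> sets borel" for S
    using that G by (simp add: integrable_real_mult_indicator mult.commute)
  have Gint: "G integrable_on {a..b}" and F_diff: "a \<le> b \<Longrightarrow> F b - F a = integral {a..b} G" for a b
  proof -
    have si: "set_integrable lborel {a..b} G"
      using int[of "{a..b}"] by (simp add: set_integrable_def mult.commute)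
    show "G integrable_on {a..b}" using set_borel_integral_eq_integral(1)[OF si] .
    assume ab: "a \<le> b"
    have "F b - F a = (LINT u|lborel. G u * indicator {..b} u - G u * indicator {..a} u)"
      unfolding F_def using int by (subst Bochner_Integration.integral_diff) auto
    also have "\<dots> = (LINT u:{a..b}|lborel. G u)"
      unfolding set_lebesgue_integral_def
    proof (rule integral_cong_AE)
      show "AE x in lborel. G x * indicator {..b} x - G x * indicator {..a} x = indicat_real {a..b} x *\<^sub>R G x"
        using AE_lborel_singleton[of a] by eventually_elim (use ab in \<open>auto simp: indicator_def\<close>)
    qed (use int[of "{a..b}"] int[of "{..b}"] int[of "{..a}"] in \<open>auto simp: mult.commute\<close>)
    finally show "F b - F a = integral {a..b} G"
      using set_borel_integral_eq_integral(2)[OF si] by simp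
  qed
  define S where "S a b c = {x \<in> {a<..<b}. \<forall>d>0. \<exists>m \<rho>. 0 < \<rho> \<and> \<rho> < d \<and> x \<in> cball m \<rho> \<and> cball m \<rho> \<subseteq> {a..b} \<and>
            c * (2 * \<rho>) < \<bar>2 * \<rho> * G x - integral (cball m \<rho>) G\<bar>}" for a b c :: real
  have "AE x in lebesgue. x \<notin> S (- real n) (real n) (1 / real (Suc k))" for n k
    using negligible_bad_difference_quotient[OF Gint, of "1 / real (Suc k)"]
    by (intro AE_not_in) (auto simp: negligible_iff_null_sets S_def)
  then have "AE x in lebesgue. \<forall>n k. x \<notin> S (- real n) (real n) (1 / real (Suc k))"
    by (simp add: AE_all_countable)
  then have "AE x in lborel. \<forall>n k. x \<notin> S (- real n) (real n) (1 / real (Suc k))"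
    by (simp add: AE_completion_iff)
  then show ?thesis
    unfolding F_def[symmetric]
  proof eventually_elim
    case (elim x)
    obtain n where n: "\<bar>x\<bar> < real n" using reals_Archimedean2 by blast
    show ?case
      unfolding has_field_derivative_iff
    proof (rule tendstoI)
      fix e :: real assume "0 < e"
      then obtain k where k: "1 / real (Suc k) < e" using nat_approx_posE by metis
      have "x \<notin> S (- real n) (real n) (1 / real (Suc k))" using elim by blast
      then have "\<exists>d>0. \<not> (\<exists>m \<rho>. 0 < \<rho> \<and> \<rho> < d \<and> x \<in> cball m \<rho> \<and> cball m \<rho> \<subseteq> {-real n..real n} \<and>
            1 / real (Suc k) * (2 * \<rho>) < \<bar>2 * \<rho> * G x - integral (cball m \<rho>) G\<bar>)"
        using n unfolding S_def by (simp add: abs_less_iff)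
      then obtain d where d: "d > 0"
        and dd: "\<And>m \<rho>. 0 < \<rho> \<Longrightarrow> \<rho> < d \<Longrightarrow> x \<in> cball m \<rho> \<Longrightarrow> cball m \<rho> \<subseteq> {-real n..real n} \<Longrightarrow>
            \<bar>2 * \<rho> * G x - integral (cball m \<rho>) G\<bar> \<le> 1 / real (Suc k) * (2 * \<rho>)"
        by (meson not_le)
      have key: "\<bar>(b - a) * G x - (F b - F a)\<bar> \<le> 1 / real (Suc k) * (b - a)"
        if "a < b" "a \<le> x" "x \<le> b" "b - a < d" "- real n \<le> a" "b \<le> real n" for a b
      proof -
        have cb: "cball ((a+b)/2) ((b-a)/2) = {a..b}"
          by (auto simp: cball_eq_atLeastAtMost field_simps)
        have "\<bar>2 * ((b-a)/2) * G x - integral (cball ((a+b)/2) ((b-a)/2)) G\<bar> \<le> 1 / real (Suc k) * (2 * ((b-a)/2))"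
          using that by (intro dd) (auto simp: cb)
        moreover have "2 * ((b - a) / 2) = b - a" by simp
        ultimately show ?thesis using F_diff[of a b] that by (simp only: cb)
      qed
      have "\<forall>\<^sub>F y in at x. dist y x < min d (real n - \<bar>x\<bar>) \<and> y \<noteq> x"
        using d n by (auto simp: eventually_at intro!: exI[of _ "min d (real n - \<bar>x\<bar>)"])
      then show "\<forall>\<^sub>F y in at x. dist ((F y - F x) / (y - x)) (G x) < e"
      proof eventually_elim
        case (elim y)
        have "\<bar>(y - x) * G x - (F y - F x)\<bar> \<le> 1 / real (Suc k) * \<bar>y - x\<bar>"
        proof (cases "x < y")
          case True
          then show ?thesis using key[of x y] elim by (auto simp: dist_real_def)
        next
          case False
          then have "\<bar>(x - y) * G x - (F x - F y)\<bar> \<le> 1 / real (Suc k) * (x - y)"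
            using key[of y x] elim by (auto simp: dist_real_def)
          moreover have "\<bar>(y - x) * G x - (F y - F x)\<bar> = \<bar>(x - y) * G x - (F x - F y)\<bar>"
            by (simp add: algebra_simps)
          ultimately show ?thesis using False by simp
        qed
        moreover have "dist ((F y - F x) / (y - x)) (G x) = \<bar>(y - x) * G x - (F y - F x)\<bar> / \<bar>y - x\<bar>"
        proof -
          have "(F y - F x) / (y - x) - G x = - (((y - x) * G x - (F y - F x)) / (y - x))"
            using elim by (simp add: field_simps)
          then show ?thesis by (simp add: dist_real_def)
        qed
        ultimately have "dist ((F y - F x) / (y - x)) (G x) \<le> 1 / real (Suc k)"
          using elim by (simp only:) (subst pos_divide_le_eq, auto)
        then show ?case using k by linarith
      qed
    qed
  qed
qed

section \<open>Differentiating planar distribution functions\<close>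

lemma AE_lborel_fst:
  assumes "AE x in lborel. P x"
  shows "AE p in lborel. P (fst (p :: real \<times> real))"
proof -
  obtain N where N: "{x \<in> space lborel. \<not> P x} \<subseteq> N" "N \<in> null_sets lborel"
    using assms by (auto elim!: AE_E simp: null_sets_def)
  have "N \<times> (UNIV :: real set) \<in> null_sets (lborel \<Otimes>\<^sub>M lborel)"
    using N(2) by (intro lborel.times_in_null_sets1) auto
  then have "AE p in lborel. p \<notin> N \<times> (UNIV :: real set)"
    unfolding lborel_prod by (rule AE_not_in)
  then show ?thesis
    by eventually_elim (use N in auto)
qed

lemma AE_lborel_snd:
  assumes "AE x in lborel. P x"
  shows "AE p in lborel. P (snd (p :: real \<times> real))"
proof -
  obtain N where N: "{x \<in> space lborel. \<not> P x} \<subseteq> N" "N \<in> null_sets lborel"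
    using assms by (auto elim!: AE_E simp: null_sets_def)
  have "(UNIV :: real set) \<times> N \<in> null_sets (lborel \<Otimes>\<^sub>M lborel)"
    using N(2) by (intro lborel.times_in_null_sets2) auto
  then have "AE p in lborel. p \<notin> (UNIV :: real set) \<times> N"
    unfolding lborel_prod by (rule AE_not_in)
  then show ?thesis
    by eventually_elim (use N in auto)
qed

lemma integrable_mult_indicator_real:
  fixes f :: "_ \<Rightarrow> real"
  assumes "integrable M f" "S \<in> sets M"
  shows "integrable M (\<lambda>p. f p * indicator S p)"
  using assms by (simp add: integrable_real_mult_indicator)

text \<open>
  The exceptional null set of \<open>x\<close> does not depend on \<open>y\<close>, so it yields a null set of the plane without
  any question of measurability. The one-dimensional theorem gives all rational \<open>y\<close> at once.
  Since \<open>f \<ge> 0\<close>, the difference quotients in \<open>x\<close> increase with \<open>y\<close>, and the claimed limit is continuous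
  in \<open>y\<close>, so an arbitrary \<open>y\<close> is squeezed between two rational ones.
\<close>

lemma AE_has_derivative_planar_distribution:
  fixes f :: "real \<times> real \<Rightarrow> real"
  assumes int: "integrable lborel f" and nonneg: "\<And>p. 0 \<le> f p"
  shows "AE x in lborel. \<forall>y. ((\<lambda>s. LINT p|lborel. f p * indicator ({..s} \<times> {..y}) p)
           has_real_derivative (LINT t|lborel. f (x, t) * indicator {..y} t)) (at x)"
proof -
  define \<Phi> where "\<Phi> s y = (LINT p|lborel. f p * indicator ({..s} \<times> {..y}) p)" for s y
  define G where "G y x = (LINT t|lborel. f (x, t) * indicator {..y} t)" for x y
  have [measurable]: "f \<in> borel_measurable borel" using int by auto
  have int2: "integrable (lborel \<Otimes>\<^sub>M lborel) f" using int by (simp add: lborel_prod)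
  have intS: "integrable lborel (\<lambda>p. f p * indicator S p)" if "S \<in> sets borel" for S
    using int that by (intro integrable_mult_indicator_real) auto
  have Gint: "integrable lborel (G y)" for y
    using lborel_pair.integrable_fst'[of "\<lambda>p. f p * indicator (UNIV \<times> {..y}) p"]
      intS[of "UNIV \<times> {..y}"]
    by (simp add: G_def[abs_def] lborel_prod indicator_times borel_Times)
  have \<Phi>_eq: "\<Phi> s y = (LINT u|lborel. G y u * indicator {..s} u)" for s y
    using lborel_pair.integral_fst'[of "\<lambda>p. f p * indicator ({..s} \<times> {..y}) p"]
      intS[of "{..s} \<times> {..y}"]
    by (simp add: G_def \<Phi>_def lborel_prod indicator_times borel_Times mult_ac
        flip: integral_mult_right_zero)
  have "AE x in lborel. \<forall>y\<in>\<rat>. ((\<lambda>s. \<Phi> s y) has_real_derivative G y x) (at x)"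
    unfolding \<Phi>_eq
    by (subst AE_ball_countable) (auto intro: countable_rat AE_has_real_derivative_integral[OF Gint])
  moreover have "AE x in lborel. integrable lborel (\<lambda>t. f (x, t))"
    using lborel_pair.AE_integrable_fst'[OF int2] .
  ultimately show ?thesis
    unfolding \<Phi>_def[symmetric] G_def[symmetric]
  proof eventually_elim
    case (elim x)
    have Gcont: "isCont (\<lambda>y. G y x) y" for y
      unfolding continuous_at_sequentially comp_def
    proof (intro allI impI)
      fix z :: "nat \<Rightarrow> real" assume z: "z \<longlonglongrightarrow> y"
      show "(\<lambda>n. G (z n) x) \<longlonglongrightarrow> G y x"
        unfolding G_def
      proof (rule integral_dominated_convergence[where w = "\<lambda>t. \<bar>f (x, t)\<bar>"])
        show "AE t in lborel. (\<lambda>n. f (x, t) * indicator {..z n} t) \<longlonglongrightarrow> f (x, t) * indicator {..y} t"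
          using AE_lborel_singleton[of y]
        proof eventually_elim
          case (elim t)
          have "\<forall>\<^sub>F n in sequentially. f (x, t) * indicator {..z n} t = f (x, t) * indicator {..y} t"
          proof (cases "t < y")
            case True
            from order_tendstoD(1)[OF z this] show ?thesis
              by eventually_elim (use True in auto)
          next
            case False
            with elim have "y < t" by auto
            from order_tendstoD(2)[OF z this] show ?thesis
              by eventually_elim (use \<open>y < t\<close> in auto)
          qed
          then show ?case by (rule tendsto_eventually)
        qed
        show "AE t in lborel. norm (f (x, t) * indicator {..z n} t) \<le> \<bar>f (x, t)\<bar>" for n
          by (auto simp: indicator_def)
      qed (use elim in auto)
    qed
    have incr: "\<Phi> s' y - \<Phi> s y \<le> \<Phi> s' y' - \<Phi> s y'" if "s \<le> s'" "y \<le> y'" for s s' y y'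
    proof -
      have eq: "\<Phi> s' y - \<Phi> s y = (LINT p|lborel. f p * indicator ({..s'} \<times> {..y}) p - f p * indicator ({..s} \<times> {..y}) p)" for y
        unfolding \<Phi>_def by (subst Bochner_Integration.integral_diff) (auto intro!: intS simp: borel_Times)
      show ?thesis
        unfolding eq
      proof (rule integral_mono)
        fix p show "f p * indicator ({..s'} \<times> {..y}) p - f p * indicator ({..s} \<times> {..y}) p
          \<le> f p * indicator ({..s'} \<times> {..y'}) p - f p * indicator ({..s} \<times> {..y'}) p"
          using that nonneg[of p] by (cases p) (auto simp: indicator_def)
      qed (auto intro!: intS simp: borel_Times)
    qed
    have mono: "(\<Phi> s y - \<Phi> x y) / (s - x) \<le> (\<Phi> s y' - \<Phi> x y') / (s - x)" if "y \<le> y'" "s \<noteq> x" for s y y'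
    proof (cases "x < s")
      case True
      then show ?thesis using incr[of x s y y'] that by (intro divide_right_mono) auto
    next
      case False
      then show ?thesis using incr[of s x y y'] that by (intro divide_right_mono_neg) auto
    qed
    show ?case
    proof
      fix y
      show "((\<lambda>s. \<Phi> s y) has_real_derivative G y x) (at x)"
        unfolding has_field_derivative_iff
      proof (rule tendstoI)
        fix e :: real assume e: "0 < e"
        from Gcont[of y] obtain d where d: "d > 0" "\<And>z. \<bar>z - y\<bar> < d \<Longrightarrow> \<bar>G z x - G y x\<bar> < e/2"
          using e unfolding continuous_at_eps_delta dist_real_def by (meson half_gt_zero)
        obtain q1 q2 where q: "q1 \<in> \<rat>" "y - d < q1" "q1 < y" "q2 \<in> \<rat>" "y < q2" "q2 < y + d"
          using Rats_dense_in_real[of "y - d" y] Rats_dense_in_real[of y "y + d"] d by auto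
        have lim: "((\<lambda>s. (\<Phi> s q - \<Phi> x q) / (s - x)) \<longlongrightarrow> G q x) (at x)" if "q \<in> \<rat>" for q
          using elim(1) that unfolding has_field_derivative_iff by blast
        have near: "\<bar>G q1 x - G y x\<bar> < e/2" "\<bar>G q2 x - G y x\<bar> < e/2" using d q by auto
        have "\<forall>\<^sub>F s in at x. s \<noteq> x" by (simp add: eventually_neq_at_within)
        moreover have "\<forall>\<^sub>F s in at x. dist ((\<Phi> s q1 - \<Phi> x q1) / (s - x)) (G q1 x) < e/2"
          "\<forall>\<^sub>F s in at x. dist ((\<Phi> s q2 - \<Phi> x q2) / (s - x)) (G q2 x) < e/2"
          using e by (intro tendstoD[OF lim] q; simp)+
        ultimately show "\<forall>\<^sub>F s in at x. dist ((\<Phi> s y - \<Phi> x y) / (s - x)) (G y x) < e"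
        proof eventually_elim
          case (elim s)
          then show ?case using near mono[of q1 y s] mono[of y q2 s] q
            unfolding dist_real_def abs_less_iff by linarith
        qed
      qed
    qed
  qed
qed

lemma integrable_product_kernel:
  fixes f :: "'a \<Rightarrow> real" and g :: "'b \<Rightarrow> real" and k :: "'a \<times> 'b \<Rightarrow> real"
  assumes "sigma_finite_measure M" "sigma_finite_measure N"
    and f: "integrable M f" and g: "integrable N g"
    and k[measurable]: "k \<in> borel_measurable (M \<Otimes>\<^sub>M N)" and bd: "\<And>z. \<bar>k z\<bar> \<le> 1"
  shows "integrable (M \<Otimes>\<^sub>M N) (\<lambda>(x, y). f x * g y * k (x, y))"
proof -
  interpret pair_sigma_finite M N using assms by (simp add: pair_sigma_finite_def)
  have [measurable]: "f \<in> borel_measurable M" "g \<in> borel_measurable N" using f g by auto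
  have "integrable (M \<Otimes>\<^sub>M N) (\<lambda>(x, y). f x * g y)"
  proof (rule Fubini_integrable)
    show "integrable M (\<lambda>x. LINT y|N. norm (case (x, y) of (x, y) \<Rightarrow> f x * g y))"
      using f by (simp add: abs_mult)
    show "AE x in M. integrable N (\<lambda>y. case (x, y) of (x, y) \<Rightarrow> f x * g y)"
      using g by simp
  qed simp
  then show ?thesis
  proof (rule Bochner_Integration.integrable_bound)
    show "AE z in M \<Otimes>\<^sub>M N. norm (case z of (x, y) \<Rightarrow> f x * g y * k (x, y)) \<le> norm (case z of (x, y) \<Rightarrow> f x * g y)"
      using bd by (auto simp: abs_mult mult_left_le)
  qed measurable
qed

text \<open>
  Completeness of \<open>lebesgue\<close> makes \<open>u\<close> measurable; this is how integrals of functions that are known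
  only almost everywhere, such as derivatives, become Borel integrals.
\<close>

lemma integral_lebesgue_eq_lborel:
  fixes u v :: "'a::euclidean_space \<Rightarrow> real"
  assumes v: "v \<in> borel_measurable borel" and ae: "AE x in lborel. u x = v x"
  shows "(LINT x|lebesgue. u x) = (LINT x|lborel. v x)"
proof -
  have vm: "v \<in> borel_measurable lebesgue" using v by (intro measurable_completion) simp
  have ae': "AE x in lebesgue. u x = v x" using ae by (rule AE_completion)
  have um: "u \<in> borel_measurable lebesgue"
    using ae' by (intro borel_measurable_AE[OF vm]) (auto elim!: eventually_mono)
  have "(LINT x|lebesgue. u x) = (LINT x|lebesgue. v x)"
    using um vm ae' by (rule integral_cong_AE)
  also have "\<dots> = (LINT x|lborel. v x)"
    using v by (intro integral_completion) simp
  finally show ?thesis .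
qed

section \<open>Permutons and their distribution functions\<close>

lemma permuton_space: "permuton \<mu> \<Longrightarrow> space \<mu> = UNIV"
  unfolding permuton_def using sets_eq_imp_space_eq[of \<mu> borel] by simp

lemma permuton_emeasure_vertical_strip:
  assumes \<mu>: "permuton \<mu>" and A: "A \<in> sets borel"
  shows "emeasure \<mu> (A \<times> UNIV) = emeasure lborel (A \<inter> {0..1})"
proof -
  have fst_meas: "fst \<in> borel_measurable \<mu>"
    using \<mu> by (simp add: permuton_def measurable_cong_sets[of \<mu> borel borel borel]
        borel_measurable_continuous_onI continuous_on_fst continuous_on_id)
  have "emeasure (distr \<mu> borel fst) A = emeasure \<mu> (fst -` A \<inter> space \<mu>)"
    using A fst_meas by (intro emeasure_distr)
  moreover have "fst -` A \<inter> space \<mu> = A \<times> UNIV" using permuton_space[OF \<mu>] by auto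
  moreover have "emeasure (distr \<mu> borel fst) A = emeasure lborel (A \<inter> {0..1})"
    using \<mu> A by (simp add: permuton_def Int_commute divide_ennreal_def)
  ultimately show ?thesis by simp
qed

lemma permuton_emeasure_horizontal_strip:
  assumes \<mu>: "permuton \<mu>" and A: "A \<in> sets borel"
  shows "emeasure \<mu> (UNIV \<times> A) = emeasure lborel (A \<inter> {0..1})"
proof -
  have snd_meas: "snd \<in> borel_measurable \<mu>"
    using \<mu> by (simp add: permuton_def measurable_cong_sets[of \<mu> borel borel borel]
        borel_measurable_continuous_onI continuous_on_snd continuous_on_id)
  have "emeasure (distr \<mu> borel snd) A = emeasure \<mu> (snd -` A \<inter> space \<mu>)"
    using A snd_meas by (intro emeasure_distr)
  moreover have "snd -` A \<inter> space \<mu> = UNIV \<times> A" using permuton_space[OF \<mu>] by auto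
  moreover have "emeasure (distr \<mu> borel snd) A = emeasure lborel (A \<inter> {0..1})"
    using \<mu> A by (simp add: permuton_def Int_commute divide_ennreal_def)
  ultimately show ?thesis by simp
qed

lemma permuton_AE_fst:
  assumes \<mu>: "permuton \<mu>" and A: "A \<in> sets borel" "emeasure lborel (A \<inter> {0..1}) = 0"
  shows "AE p in \<mu>. fst p \<notin> A"
proof -
  have "A \<times> UNIV \<in> null_sets \<mu>"
    using permuton_emeasure_vertical_strip[OF \<mu> A(1)] A \<mu>
    by (auto simp: null_sets_def permuton_def borel_Times)
  from AE_not_in[OF this] show ?thesis by eventually_elim auto
qed

lemma permuton_AE_snd:
  assumes \<mu>: "permuton \<mu>" and A: "A \<in> sets borel" "emeasure lborel (A \<inter> {0..1}) = 0"
  shows "AE p in \<mu>. snd p \<notin> A"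
proof -
  have "UNIV \<times> A \<in> null_sets \<mu>"
    using permuton_emeasure_horizontal_strip[OF \<mu> A(1)] A \<mu>
    by (auto simp: null_sets_def permuton_def borel_Times)
  from AE_not_in[OF this] show ?thesis by eventually_elim auto
qed

lemma permuton_AE_unit_square:
  assumes \<mu>: "permuton \<mu>"
  shows "AE p in \<mu>. p \<in> unit_square"
proof -
  have "(- {0<..<1}) \<inter> {0..1} = {0, 1::real}" by auto
  then have *: "emeasure lborel ((- {0<..<1}) \<inter> {0..1::real}) = 0"
    by (simp add: emeasure_lborel_countable)
  show ?thesis
    using permuton_AE_fst[OF \<mu> _ *] permuton_AE_snd[OF \<mu> _ *] by (auto simp: mem_Times_iff)
qed

lemma permuton_AE_neq:
  assumes \<mu>: "permuton \<mu>"
  shows "AE p in \<mu>. fst p \<noteq> x" "AE p in \<mu>. snd p \<noteq> y"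
proof -
  have *: "emeasure lborel ({z} \<inter> {0..1::real}) = 0" for z :: real
    by (simp add: emeasure_lborel_countable countable_Int1)
  show "AE p in \<mu>. fst p \<noteq> x" "AE p in \<mu>. snd p \<noteq> y"
    using permuton_AE_fst[OF \<mu> _ *, of x] permuton_AE_snd[OF \<mu> _ *, of y] by auto
qed

lemma permuton_measure_strip:
  assumes \<mu>: "permuton \<mu>" and ab: "0 \<le> a" "a \<le> b" "b \<le> 1"
  shows "measure \<mu> ({a..b} \<times> UNIV) = b - a" "measure \<mu> (UNIV \<times> {a..b}) = b - a"
  using permuton_emeasure_vertical_strip[OF \<mu>, of "{a..b}"]
    permuton_emeasure_horizontal_strip[OF \<mu>, of "{a..b}"] ab
  by (auto simp: measure_def Int_absorb2)

text \<open>
  Boundaries and single lines carry no mass, so two sets have the same mass if they agree inside the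
  open square off one vertical and one horizontal line. This absorbs every distinction between
  open, closed and unbounded rectangles.
\<close>

lemma permuton_measure_cong:
  assumes \<mu>: "permuton \<mu>" and "A \<in> sets borel" "B \<in> sets borel"
    and "\<And>x y. 0 < x \<Longrightarrow> x < 1 \<Longrightarrow> 0 < y \<Longrightarrow> y < 1 \<Longrightarrow> x \<noteq> a \<Longrightarrow> y \<noteq> b \<Longrightarrow> (x, y) \<in> A \<longleftrightarrow> (x, y) \<in> B"
  shows "measure \<mu> A = measure \<mu> B"
proof (rule measure_eq_AE)
  show "AE p in \<mu>. (p \<in> A) = (p \<in> B)"
    using permuton_AE_unit_square[OF \<mu>] permuton_AE_neq(1)[OF \<mu>, of a] permuton_AE_neq(2)[OF \<mu>, of b]
    by eventually_elim (use assms(4) in \<open>auto simp: mem_Times_iff\<close>)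
qed (use assms in \<open>auto simp: permuton_def\<close>)

lemma permuton_measure_lower_left:
  assumes \<mu>: "permuton \<mu>" and xy: "0 \<le> x" "x \<le> 1" "0 \<le> y" "y \<le> 1"
  shows "measure \<mu> ({..x} \<times> {..y}) = y - measure \<mu> ({x..1} \<times> {0..y})"
proof -
  interpret prob_space \<mu> using \<mu> by (simp add: permuton_def)
  have sets: "sets \<mu> = sets borel" using \<mu> by (simp add: permuton_def)
  have "y = measure \<mu> (UNIV \<times> {0..y})" using permuton_measure_strip(2)[OF \<mu>, of 0 y] xy by simp
  also have "\<dots> = measure \<mu> ({..x} \<times> {..y} \<union> {x<..1} \<times> {0..y})"
    by (rule permuton_measure_cong[OF \<mu>]) (use xy in \<open>auto simp: borel_Times\<close>)
  also have "\<dots> = measure \<mu> ({..x} \<times> {..y}) + measure \<mu> ({x<..1} \<times> {0..y})"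
    by (rule finite_measure_Union) (auto simp: sets borel_Times)
  also have "measure \<mu> ({x<..1} \<times> {0..y}) = measure \<mu> ({x..1} \<times> {0..y})"
    by (rule permuton_measure_cong[OF \<mu>, of _ _ x]) (use xy in \<open>auto simp: borel_Times\<close>)
  finally show ?thesis by simp
qed

text \<open>
  The quadrants \<open>{..a}\<close> form an intersection-stable generator of the Borel sets of the plane, and their
  masses are determined by the values of \<open>h\<close> at the point \<open>a\<close> clamped to the unit square.
\<close>

lemma permuton_of_unique:
  assumes \<mu>: "permuton_of h \<mu>" and \<nu>: "permuton_of h \<nu>"
  shows "\<mu> = \<nu>"
proof (rule measure_eqI_generator_eq[where E = "range (\<lambda>a. {..a :: real \<times> real})" and \<Omega> = UNIV
      and A = "\<lambda>n. {..(real n, real n)}"])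
  have pm: "permuton \<mu>" "permuton \<nu>" using \<mu> \<nu> by (auto simp: permuton_of_def)
  interpret M: prob_space \<mu> using pm by (simp add: permuton_def)
  interpret N: prob_space \<nu> using pm by (simp add: permuton_def)
  have ll: "measure \<mu> ({..a} \<times> {..b}) = measure \<nu> ({..a} \<times> {..b})" for a b
  proof -
    define x y where "x = max 0 (min 1 a)" and "y = max 0 (min 1 b)"
    have eq: "measure \<rho> ({..a} \<times> {..b}) = y - h x y" if "permuton_of h \<rho>" for \<rho>
    proof -
      from that have \<rho>: "permuton \<rho>" and h: "h x y = measure \<rho> ({x..1} \<times> {0..y})"
        by (auto simp: permuton_of_def x_def y_def)
      have "measure \<rho> ({..a} \<times> {..b}) = measure \<rho> ({..x} \<times> {..y})"
        by (rule permuton_measure_cong[OF \<rho>]) (auto simp: x_def y_def borel_Times)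
      then show ?thesis
        using permuton_measure_lower_left[OF \<rho>, of x y] by (simp add: h) (simp add: x_def y_def)
    qed
    show ?thesis using eq[OF \<mu>] eq[OF \<nu>] by simp
  qed
  show "Int_stable (range (\<lambda>a. {..a :: real \<times> real}))"
  proof (rule Int_stableI_image)
    fix a b :: "real \<times> real"
    show "\<exists>c\<in>UNIV. {..a} \<inter> {..b} = {..c}"
      by (intro bexI[of _ "(min (fst a) (fst b), min (snd a) (snd b))"]) (auto simp: less_eq_prod_def)
  qed
  show "range (\<lambda>a. {..a :: real \<times> real}) \<subseteq> Pow UNIV" by auto
  fix X assume "X \<in> range (\<lambda>a. {..a :: real \<times> real})"
  then obtain a b where "X = {..(a, b)}" by auto
  also have "\<dots> = {..a} \<times> {..b}" by (auto simp: less_eq_prod_def)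
  finally show "emeasure \<mu> X = emeasure \<nu> X"
    using ll by (simp add: M.emeasure_eq_measure N.emeasure_eq_measure)
next
  show "sets \<mu> = sigma_sets UNIV (range (\<lambda>a. {..a :: real \<times> real}))"
    "sets \<nu> = sigma_sets UNIV (range (\<lambda>a. {..a :: real \<times> real}))"
    using \<mu> \<nu> by (simp_all add: permuton_of_def permuton_def borel_eq_atMost)
  show "(\<Union>n. {..(real n, real n)}) = UNIV"
  proof (intro equalityI subsetI UNIV_I)
    fix p :: "real \<times> real"
    obtain n m where "fst p \<le> real n" "snd p \<le> real m" using real_arch_simple by metis
    then have "p \<in> {..(real (max n m), real (max n m))}"
      by (auto simp: less_eq_prod_def)
    then show "p \<in> (\<Union>n. {..(real n, real n)})" by blast
  qed
  interpret M: prob_space \<mu> using \<mu> by (simp add: permuton_of_def permuton_def)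
  show "emeasure \<mu> {..(real i, real i)} \<noteq> \<infinity>" for i by simp
qed auto

lemma permuton_rectangle:
  assumes \<mu>: "permuton \<mu>" and x: "0 \<le> x1" "x1 \<le> x2" "x2 \<le> 1" and y: "0 \<le> y1" "y1 \<le> y2" "y2 \<le> 1"
  defines "h \<equiv> \<lambda>x y. measure \<mu> ({x..1} \<times> {0..y})"
  shows "h x1 y1 + h x2 y2 - h x1 y2 - h x2 y1 = - measure \<mu> ({x1..x2} \<times> {y1..y2})"
proof -
  interpret prob_space \<mu> using \<mu> by (simp add: permuton_def)
  have sets: "sets \<mu> = sets borel" using \<mu> by (simp add: permuton_def)
  have split: "h a y2 = h a y1 + measure \<mu> ({a..1} \<times> {y1..y2})" if a: "0 \<le> a" "a \<le> 1" for a
  proof -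
    have "h a y2 = measure \<mu> ({a..1} \<times> {0..y1} \<union> {a..1} \<times> {y1<..y2})"
      unfolding h_def by (rule arg_cong[where f = "measure \<mu>"]) (use y in auto)
    also have "\<dots> = h a y1 + measure \<mu> ({a..1} \<times> {y1<..y2})"
      unfolding h_def by (rule finite_measure_Union) (auto simp: sets borel_Times)
    also have "measure \<mu> ({a..1} \<times> {y1<..y2}) = measure \<mu> ({a..1} \<times> {y1..y2})"
      by (rule permuton_measure_cong[OF \<mu>, where b = y1]) (auto simp: borel_Times)
    finally show ?thesis .
  qed
  have "measure \<mu> ({x1..1} \<times> {y1..y2}) = measure \<mu> ({x1..x2} \<times> {y1..y2} \<union> {x2<..1} \<times> {y1..y2})"
    by (rule arg_cong[where f = "measure \<mu>"]) (use x in auto)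
  also have "\<dots> = measure \<mu> ({x1..x2} \<times> {y1..y2}) + measure \<mu> ({x2<..1} \<times> {y1..y2})"
    by (rule finite_measure_Union) (auto simp: sets borel_Times)
  also have "measure \<mu> ({x2<..1} \<times> {y1..y2}) = measure \<mu> ({x2..1} \<times> {y1..y2})"
    by (rule permuton_measure_cong[OF \<mu>, where a = x2]) (auto simp: borel_Times)
  finally show ?thesis using split[of x1] split[of x2] x by simp
qed

text \<open>
  Once the boundary values are known, the rectangle identity with one side on the boundary of the square
  expresses each increment of \<open>h\<close> in one variable as the mass of a strip of that width, whence the Lipschitz bounds.
\<close>

lemma permuton_in_class_F:
  assumes \<mu>: "permuton \<mu>"
  shows "(\<lambda>x y. measure \<mu> ({x..1} \<times> {0..y})) \<in> class_F"
proof -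
  define h where "h = (\<lambda>x y. measure \<mu> ({x..1} \<times> {0..y}))"
  interpret prob_space \<mu> using \<mu> by (simp add: permuton_def)
  have sets: "sets \<mu> = sets borel" using \<mu> by (simp add: permuton_def)
  have rect: "h x1 y1 + h x2 y2 - h x1 y2 - h x2 y1 = - measure \<mu> ({x1..x2} \<times> {y1..y2})"
    if "0 \<le> x1" "x1 \<le> x2" "x2 \<le> 1" "0 \<le> y1" "y1 \<le> y2" "y2 \<le> 1" for x1 x2 y1 y2
    using permuton_rectangle[OF \<mu>] that unfolding h_def by blast
  have h_bot: "h x 0 = 0" if "0 \<le> x" "x \<le> 1" for x
  proof -
    have "h x 0 = measure \<mu> {}" unfolding h_def
      by (rule permuton_measure_cong[OF \<mu>, where b = 0]) (auto simp: borel_Times)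
    then show ?thesis by simp
  qed
  have h_right: "h 1 y = 0" if "0 \<le> y" "y \<le> 1" for y
  proof -
    have "h 1 y = measure \<mu> {}" unfolding h_def
      by (rule permuton_measure_cong[OF \<mu>, where a = 1]) (auto simp: borel_Times)
    then show ?thesis by simp
  qed
  have h_top: "h x 1 = 1 - x" if "0 \<le> x" "x \<le> 1" for x
  proof -
    have "h x 1 = measure \<mu> ({x..1} \<times> UNIV)" unfolding h_def
      by (rule permuton_measure_cong[OF \<mu>]) (auto simp: borel_Times)
    then show ?thesis using permuton_measure_strip(1)[OF \<mu>, of x 1] that by simp
  qed
  have h_left: "h 0 y = y" if "0 \<le> y" "y \<le> 1" for y
  proof -
    have "h 0 y = measure \<mu> (UNIV \<times> {0..y})" unfolding h_def
      by (rule permuton_measure_cong[OF \<mu>]) (auto simp: borel_Times)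
    then show ?thesis using permuton_measure_strip(2)[OF \<mu>, of 0 y] that by simp
  qed
  have small: "measure \<mu> ({x1..x2} \<times> {y1..y2}) \<le> x2 - x1" "measure \<mu> ({x1..x2} \<times> {y1..y2}) \<le> y2 - y1"
    if "0 \<le> x1" "x1 \<le> x2" "x2 \<le> 1" "0 \<le> y1" "y1 \<le> y2" "y2 \<le> 1" for x1 x2 y1 y2
  proof -
    have "measure \<mu> ({x1..x2} \<times> {y1..y2}) \<le> measure \<mu> ({x1..x2} \<times> UNIV)"
      "measure \<mu> ({x1..x2} \<times> {y1..y2}) \<le> measure \<mu> (UNIV \<times> {y1..y2})"
      by (auto intro!: finite_measure_mono simp: sets borel_Times)
    then show "measure \<mu> ({x1..x2} \<times> {y1..y2}) \<le> x2 - x1" "measure \<mu> ({x1..x2} \<times> {y1..y2}) \<le> y2 - y1"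
      using permuton_measure_strip[OF \<mu>] that by auto
  qed
  have lip: "1-lipschitz_on {0..1} u" if "\<And>s t. 0 \<le> s \<Longrightarrow> s \<le> t \<Longrightarrow> t \<le> 1 \<Longrightarrow> \<bar>u t - u s\<bar> \<le> t - s" for u :: "real \<Rightarrow> real"
  proof (rule lipschitz_onI)
    fix s t :: real assume "s \<in> {0..1}" "t \<in> {0..1}"
    then show "dist (u s) (u t) \<le> 1 * dist s t"
      using that[of s t] that[of t s] by (cases "s \<le> t") (auto simp: dist_real_def abs_minus_commute)
  qed simp
  have "1-lipschitz_on {0..1} (\<lambda>x. h x y)" if "y \<in> {0..1}" for y
  proof (rule lip)
    fix s t :: real assume st: "0 \<le> s" "s \<le> t" "t \<le> 1"
    have "h t y - h s y = - measure \<mu> ({s..t} \<times> {0..y})"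
      using rect[of s t 0 y] st that h_bot[of s] h_bot[of t] by auto
    then show "\<bar>h t y - h s y\<bar> \<le> t - s" using small(1)[of s t 0 y] st that by simp
  qed
  moreover have "1-lipschitz_on {0..1} (\<lambda>y. h x y)" if "x \<in> {0..1}" for x
  proof (rule lip)
    fix s t :: real assume st: "0 \<le> s" "s \<le> t" "t \<le> 1"
    have "h x t - h x s = measure \<mu> ({x..1} \<times> {s..t})"
      using rect[of x 1 s t] st that h_right[of s] h_right[of t] by auto
    then show "\<bar>h x t - h x s\<bar> \<le> t - s" using small(2)[of x 1 s t] st that by simp
  qed
  moreover have "h x1 y1 + h x2 y2 - h x1 y2 - h x2 y1 \<le> 0"
    if "0 \<le> x1 \<and> x1 < x2 \<and> x2 \<le> 1 \<and> 0 \<le> y1 \<and> y1 < y2 \<and> y2 \<le> 1" for x1 x2 y1 y2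
    using rect[of x1 x2 y1 y2] that by simp
  ultimately show ?thesis
    unfolding h_def[symmetric] class_F_def
    using h_bot h_right h_top h_left by simp
qed

section \<open>Densities of permutons\<close>

lemma unit_square_borel [measurable]: "unit_square \<in> sets borel"
  by (simp add: borel_Times)

lemma integrable_indicator_unit_square: "integrable lborel (indicator unit_square :: real \<times> real \<Rightarrow> real)"
proof -
  have "unit_square = box (0, 0) (1, 1 :: real)"
    by (auto simp: box_def Basis_prod_def)
  then show ?thesis using emeasure_lborel_box_finite[of "(0,0)" "(1,1) :: real \<times> real"]
    by (simp add: integrable_indicator_iff)
qed

lemma integrable_bounded_on_unit_square:
  fixes f :: "real \<times> real \<Rightarrow> real"
  assumes "f \<in> borel_measurable borel" "\<And>p. \<bar>f p\<bar> \<le> M" "\<And>p. p \<notin> unit_square \<Longrightarrow> f p = 0"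
  shows "integrable lborel f"
proof (rule Bochner_Integration.integrable_bound)
  show "integrable lborel (\<lambda>p. M * indicator unit_square p)"
    using integrable_indicator_unit_square by simp
  show "AE p in lborel. norm (f p) \<le> norm (M * indicator unit_square p)"
    using assms(2,3) by (intro AE_I2) (auto simp: indicator_def abs_mult intro: order_trans[OF _ abs_ge_self])
qed (use assms in simp)

text \<open>
  A density with good values everywhere: pointwise non-negativity and pointwise vanishing off the open square
  allow densities to be perturbed and integrated over the whole plane without exceptional sets.
\<close>

definition permuton_pdf :: "(real \<times> real) measure \<Rightarrow> (real \<times> real \<Rightarrow> real) \<Rightarrow> bool" where
  "permuton_pdf \<mu> f \<longleftrightarrow> permuton \<mu> \<and> f \<in> borel_measurable borel \<and> (\<forall>p. 0 \<le> f p) \<and>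
     (\<forall>p. p \<notin> unit_square \<longrightarrow> f p = 0) \<and> \<mu> = density lborel (\<lambda>p. ennreal (f p))"

lemma permuton_pdfD:
  assumes "permuton_pdf \<mu> f"
  shows "permuton \<mu>" "f \<in> borel_measurable borel" "0 \<le> f p" "p \<notin> unit_square \<Longrightarrow> f p = 0"
    "\<mu> = density lborel (\<lambda>p. ennreal (f p))"
  using assms unfolding permuton_pdf_def by blast+

lemma permuton_pdf_integrable:
  assumes "permuton_pdf \<mu> f"
  shows "integrable lborel f"
proof (rule integrableI_nonneg)
  note D = permuton_pdfD[OF assms]
  show "f \<in> borel_measurable lborel" using D(2) by simp
  show "AE x in lborel. 0 \<le> f x" using D(3) by simp
  have "emeasure \<mu> UNIV = 1"
    using D(1) prob_space.emeasure_space_1[of \<mu>] permuton_space[OF D(1)] by (simp add: permuton_def)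
  moreover have "emeasure \<mu> UNIV = (\<integral>\<^sup>+ x. ennreal (f x) \<partial>lborel)"
    using D(2) by (subst D(5)) (simp add: emeasure_density)
  ultimately show "(\<integral>\<^sup>+ x. ennreal (f x) \<partial>lborel) < \<infinity>" by simp
qed

lemma permuton_pdf_measure:
  assumes f: "permuton_pdf \<mu> f" and A: "A \<in> sets borel"
  shows "measure \<mu> A = (LINT p|lborel. f p * indicator A p)"
proof -
  note D = permuton_pdfD[OF f]
  have "emeasure \<mu> A = (\<integral>\<^sup>+ p. ennreal (f p * indicator A p) \<partial>lborel)"
    using D(2,3) A by (subst D(5)) (auto simp: emeasure_density intro!: nn_integral_cong split: split_indicator)
  also have "\<dots> = ennreal (LINT p|lborel. f p * indicator A p)"
    using D(3) A permuton_pdf_integrable[OF f]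
    by (intro nn_integral_eq_integral integrable_mult_indicator_real) auto
  finally show ?thesis using D(3) by (simp add: measure_def Bochner_Integration.integral_nonneg)
qed

text \<open>
  Locally \<open>h(x,y) = y - \<mu>({..x} \<times> {..y})\<close>. Applying the differentiation theorem to \<open>f\<close> and to \<open>f\<close> with swapped
  coordinates gives \<open>- P\<close> and \<open>1 - R\<close> for the derivatives. That the sections of \<open>f\<close> integrate to \<open>1\<close> comes
  from the same theorem on the boundary: along \<open>y = 1\<close> the distribution function is \<open>x\<close>, whose derivative is \<open>1\<close>.
\<close>

lemma permuton_pdf_partial_derivatives:
  assumes f: "permuton_pdf \<mu> f" and h: "permuton_of h \<mu>"
  shows "AE p in lborel. p \<in> unit_square \<longrightarrow>
      deriv (\<lambda>s. h s (snd p)) (fst p) = - (LINT t|lborel. f (fst p, t) * indicator {..snd p} t) \<and>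
      deriv (\<lambda>t. h (fst p) t) (snd p) = (LINT s|lborel. f (s, snd p) * indicator {fst p<..} s) \<and>
      0 \<le> (LINT t|lborel. f (fst p, t) * indicator {..snd p} t) \<and>
      (LINT t|lborel. f (fst p, t) * indicator {..snd p} t) \<le> 1 \<and>
      0 \<le> (LINT s|lborel. f (s, snd p) * indicator {fst p<..} s) \<and>
      (LINT s|lborel. f (s, snd p) * indicator {fst p<..} s) \<le> 1"
proof -
  note D = permuton_pdfD[OF f]
  note [measurable] = D(2)
  note int = permuton_pdf_integrable[OF f]
  have int2: "integrable (lborel \<Otimes>\<^sub>M lborel) f" using int by (simp add: lborel_prod)
  have intS: "integrable lborel (\<lambda>p. f p * indicator S p)" if "S \<in> sets borel" for S
    using int that by (intro integrable_mult_indicator_real) auto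
  define H where "H x y = (LINT p|lborel. f p * indicator ({..x} \<times> {..y}) p)" for x y
  have H: "H x y = y - h x y" if "0 \<le> x" "x \<le> 1" "0 \<le> y" "y \<le> 1" for x y
    using permuton_measure_lower_left[OF D(1), of x y] that h permuton_pdf_measure[OF f, of "{..x} \<times> {..y}"]
    by (auto simp: H_def permuton_of_def borel_Times)
  have top: "h x 1 = 1 - x" if "0 \<le> x" "x \<le> 1" for x
    using permuton_in_class_F[OF D(1)] h that by (auto simp: class_F_def permuton_of_def)
  have right: "h 1 y = 0" if "0 \<le> y" "y \<le> 1" for y
    using permuton_in_class_F[OF D(1)] h that by (auto simp: class_F_def permuton_of_def)
  have 1: "AE x in lborel. \<forall>y. ((\<lambda>s. H s y) has_real_derivative
      (LINT t|lborel. f (x, t) * indicator {..y} t)) (at x)"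
    unfolding H_def by (rule AE_has_derivative_planar_distribution[OF int D(3)])
  let ?f' = "\<lambda>p. f (snd p, fst p)"
  have "integrable lborel ?f'"
    using lborel_pair.integrable_product_swap[OF int2] by (simp add: case_prod_beta' lborel_prod)
  moreover have "(LINT p|lborel. ?f' p * indicator ({..s} \<times> {..y}) p) = H y s" for s y
  proof -
    have "(LINT p|(lborel \<Otimes>\<^sub>M lborel). (case p of (b, a) \<Rightarrow> f (a, b) * indicator ({..y} \<times> {..s}) (a, b)))
        = (LINT p|(lborel \<Otimes>\<^sub>M lborel). f p * indicator ({..y} \<times> {..s}) p)"
      by (rule lborel_pair.integral_product_swap) (unfold lborel_prod, use intS[of "{..y} \<times> {..s}"] in \<open>auto simp: borel_Times\<close>)
    moreover have "(case p of (b, a) \<Rightarrow> f (a, b) * indicator ({..y} \<times> {..s}) (a, b))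
        = ?f' p * indicator ({..s} \<times> {..y}) p" for p :: "real \<times> real"
      by (cases p) (auto simp: indicator_def)
    ultimately show ?thesis by (simp add: H_def lborel_prod)
  qed
  ultimately have 2: "AE y in lborel. \<forall>x. ((\<lambda>t. H x t) has_real_derivative
      (LINT s|lborel. f (s, y) * indicator {..x} s)) (at y)"
    using AE_has_derivative_planar_distribution[of ?f'] D(3) by simp
  have 3: "AE x in lborel. integrable lborel (\<lambda>t. f (x, t))"
    by (rule lborel_pair.AE_integrable_fst'[OF int2])
  have 4: "AE y in lborel. integrable lborel (\<lambda>s. f (s, y))"
    using lborel_pair.AE_integrable_snd[of "\<lambda>a b. f (a, b)"] int2 by simp
  have op: "open {0<..<1::real}" by simp
  show ?thesis
    using AE_lborel_fst[OF 1] AE_lborel_snd[OF 2] AE_lborel_fst[OF 3] AE_lborel_snd[OF 4]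
  proof eventually_elim
    case (elim p)
    obtain x y where p: "p = (x, y)" by (cases p)
    define P where "P y = (LINT t|lborel. f (x, t) * indicator {..y} t)" for y
    define R where "R x = (LINT s|lborel. f (s, y) * indicator {..x} s)" for x
    define Q where "Q = (LINT s|lborel. f (s, y) * indicator {x<..} s)"
    have d1: "((\<lambda>s. H s z) has_real_derivative P z) (at x)" for z
      using elim(1) by (simp add: p P_def)
    have d2: "((\<lambda>t. H z t) has_real_derivative R z) (at y)" for z
      using elim(2) by (simp add: p R_def)
    have ix: "integrable lborel (\<lambda>t. f (x, t))" and iy: "integrable lborel (\<lambda>s. f (s, y))"
      using elim by (simp_all add: p)
    show ?case
    proof
      assume "p \<in> unit_square"
      then have xy: "0 < x" "x < 1" "0 < y" "y < 1" by (auto simp: p)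
      have e1: "((\<lambda>s. h s y) has_real_derivative - P y) (at x)"
      proof (rule has_field_derivative_transform_within_open[OF _ op])
        show "((\<lambda>s. y - H s y) has_real_derivative - P y) (at x)"
          by (auto intro!: derivative_eq_intros d1)
      qed (use xy H in auto)
      have e2: "((\<lambda>t. h x t) has_real_derivative 1 - R x) (at y)"
      proof (rule has_field_derivative_transform_within_open[OF _ op])
        show "((\<lambda>t. t - H x t) has_real_derivative 1 - R x) (at y)"
          by (auto intro!: derivative_eq_intros d2)
      qed (use xy H in auto)
      \<comment> \<open>On the line \<open>y = 1\<close> the distribution function is the identity, so the full section integral \<open>P 1\<close> is \<open>1\<close>.\<close>
      have "((\<lambda>s. s) has_real_derivative P 1) (at x)"
      proof (rule has_field_derivative_transform_within_open[OF d1 op])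
        show "H s 1 = s" if "s \<in> {0<..<1}" for s using that H[of s 1] top[of s] by simp
      qed (use xy in auto)
      from DERIV_unique[OF this DERIV_ident] have P1: "P 1 = 1" .
      have "((\<lambda>s. s) has_real_derivative R 1) (at y)"
      proof (rule has_field_derivative_transform_within_open[OF d2 op])
        show "H 1 s = s" if "s \<in> {0<..<1}" for s using that H[of 1 s] right[of s] by simp
      qed (use xy in auto)
      from DERIV_unique[OF this DERIV_ident] have R1: "R 1 = 1" .
      have Pmono: "P y \<le> P 1" unfolding P_def
        by (rule integral_mono) (use ix D(3) xy in \<open>auto intro!: integrable_mult_indicator_real mult_left_mono split: split_indicator\<close>)
      have P0: "0 \<le> P y" unfolding P_def using D(3) by (intro Bochner_Integration.integral_nonneg) auto
      have Q0: "0 \<le> Q" unfolding Q_def using D(3) by (intro Bochner_Integration.integral_nonneg) auto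
      have R0: "0 \<le> R x" unfolding R_def using D(3) by (intro Bochner_Integration.integral_nonneg) auto
      have RQ: "R x + Q = R 1"
      proof -
        have "R x + Q = (LINT s|lborel. f (s, y) * indicator {..x} s + f (s, y) * indicator {x<..} s)"
          unfolding R_def Q_def using iy
          by (subst Bochner_Integration.integral_add) (auto intro!: integrable_mult_indicator_real)
        also have "\<dots> = R 1" unfolding R_def
          by (rule Bochner_Integration.integral_cong) (use xy D(4) in \<open>auto split: split_indicator\<close>)
        finally show ?thesis .
      qed
      show "deriv (\<lambda>s. h s (snd p)) (fst p) = - (LINT t|lborel. f (fst p, t) * indicator {..snd p} t) \<and>
        deriv (\<lambda>t. h (fst p) t) (snd p) = (LINT s|lborel. f (s, snd p) * indicator {fst p<..} s) \<and>
        0 \<le> (LINT t|lborel. f (fst p, t) * indicator {..snd p} t) \<and>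
        (LINT t|lborel. f (fst p, t) * indicator {..snd p} t) \<le> 1 \<and>
        0 \<le> (LINT s|lborel. f (s, snd p) * indicator {fst p<..} s) \<and>
        (LINT s|lborel. f (s, snd p) * indicator {fst p<..} s) \<le> 1"
        using DERIV_imp_deriv[OF e1] DERIV_imp_deriv[OF e2] P0 Pmono P1 Q0 R0 RQ R1
        by (simp add: p P_def[symmetric] Q_def[symmetric])
    qed
  qed
qed

section \<open>The energy as a functional of the density\<close>

text \<open>
  Half-open, so that it matches \<open>{..y}\<close> and \<open>{x<..}\<close> in the partial derivatives.
\<close>

definition north_east :: "real \<times> real \<Rightarrow> (real \<times> real) set" where
  "north_east p = {fst p<..} \<times> {snd p..}"

text \<open>
  For \<open>f = g\<close> the density of \<open>\<mu>\<close>: the probability that of two independent \<open>\<mu>\<close>-distributed points the second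
  lies to the north-east of the first.
\<close>

definition concordance :: "(real \<times> real \<Rightarrow> real) \<Rightarrow> (real \<times> real \<Rightarrow> real) \<Rightarrow> real" where
  "concordance f g = (LINT p|lborel. LINT q|lborel. f p * g q * indicator (north_east p) q)"

lemma borel_measurable_north_east:
  "(\<lambda>z. indicator (north_east (fst z)) (snd z) :: real)
     \<in> borel_measurable ((lborel :: (real \<times> real) measure) \<Otimes>\<^sub>M (lborel :: (real \<times> real) measure))"
proof -
  have "(\<lambda>z. indicator (north_east (fst z)) (snd z) :: real) =
    (\<lambda>z :: (real \<times> real) \<times> (real \<times> real). if fst (fst z) < fst (snd z) \<and> snd (fst z) \<le> snd (snd z) then 1 else 0)"
    by (auto simp: north_east_def indicator_def mem_Times_iff)
  also have "\<dots> \<in> borel_measurable (borel \<Otimes>\<^sub>M borel)"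
    unfolding borel_prod[symmetric] by measurable
  finally show ?thesis
    by (simp add: measurable_cong_sets[OF sets_pair_measure_cong[OF sets_lborel sets_lborel] refl])
qed

text \<open>
  At \<open>(x,y)\<close> the product under the integral on the left integrates \<open>f(x,t) f(s,y)\<close> over \<open>t \<le> y\<close> and \<open>s > x\<close>, which says that
  \<open>(s,y)\<close> is to the north-east of \<open>(x,t)\<close>. For almost every \<open>x\<close>, exchanging the integrals over \<open>y\<close> and \<open>t\<close>
  collects the variables into the two points \<open>(x,t)\<close> and \<open>(s,y)\<close>.
\<close>

lemma concordance_eq_integral_of_marginals:
  assumes int: "integrable lborel f"
    and PQ: "integrable lborel (\<lambda>p. (LINT t|lborel. f (fst p, t) * indicator {..snd p} t)
                    * (LINT s|lborel. f (s, snd p) * indicator {fst p<..} s))"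
  shows "(LINT p|lborel. (LINT t|lborel. f (fst p, t) * indicator {..snd p} t)
                    * (LINT s|lborel. f (s, snd p) * indicator {fst p<..} s)) = concordance f f"
proof -
  have [measurable]: "f \<in> borel_measurable borel" using int by auto
  have int2: "integrable (lborel \<Otimes>\<^sub>M lborel) f" using int by (simp add: lborel_prod)
  define Q where "Q x y = (LINT s|lborel. f (s, y) * indicator {x<..} s)" for x y
  have intQ: "integrable (lborel \<Otimes>\<^sub>M lborel) (\<lambda>(s, y). f (s, y) * indicator {x<..} s * indicator {t..} y)" for x t
    using integrable_mult_indicator_real[OF int2, of "{x<..} \<times> {t..}"]
    by (simp add: case_prod_beta' indicator_times mult_ac)
  have Qint: "integrable lborel (Q x)" for x
  proof -
    have "integrable (lborel \<Otimes>\<^sub>M lborel) (\<lambda>(s, y). f (s, y) * indicator {x<..} s)"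
      using integrable_mult_indicator_real[OF int2, of "{x<..} \<times> UNIV"]
      by (simp add: case_prod_beta' indicator_times mult_ac)
    from lborel_pair.integrable_snd[OF this] show ?thesis by (simp add: Q_def[abs_def])
  qed
  define K where "K p = (LINT q|lborel. f q * indicator (north_east p) q)" for p
  have K: "K (x, t) = (LINT y|lborel. Q x y * indicator {t..} y)" for x t
  proof -
    have "K (x, t) = (LINT q|(lborel \<Otimes>\<^sub>M lborel). (case q of (s, y) \<Rightarrow> f (s, y) * indicator {x<..} s * indicator {t..} y))"
      unfolding K_def lborel_prod
      by (rule Bochner_Integration.integral_cong) (auto simp: north_east_def indicator_def)
    also have "\<dots> = (LINT y|lborel. LINT s|lborel. f (s, y) * indicator {x<..} s * indicator {t..} y)"
      by (rule lborel_pair.integral_snd[OF intQ, symmetric])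
    finally show ?thesis by (simp add: Q_def)
  qed
  have intK: "integrable (lborel \<Otimes>\<^sub>M lborel) (\<lambda>p. f p * K p)"
  proof -
    have "integrable ((lborel :: (real \<times> real) measure) \<Otimes>\<^sub>M (lborel :: (real \<times> real) measure))
       (\<lambda>(p, q). f p * f q * (\<lambda>z. indicator (north_east (fst z)) (snd z)) (p, q))"
      by (rule integrable_product_kernel[OF _ _ int int borel_measurable_north_east])
        (auto intro: lborel.sigma_finite_measure_axioms simp: indicator_def)
    then have "integrable ((lborel :: (real \<times> real) measure) \<Otimes>\<^sub>M (lborel :: (real \<times> real) measure))
       (\<lambda>(p, q). f p * f q * indicator (north_east p) q)" by simp
    from pair_sigma_finite.integrable_fst[OF _ this] show ?thesis
      by (simp add: K_def lborel_prod mult.assoc pair_sigma_finite_def lborel.sigma_finite_measure_axioms)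
  qed
  have "(LINT p|lborel. (LINT t|lborel. f (fst p, t) * indicator {..snd p} t) * Q (fst p) (snd p))
     = (LINT x|lborel. LINT y|lborel. (LINT t|lborel. f (x, t) * indicator {..y} t) * Q x y)"
    using lborel_pair.integral_fst'[of "\<lambda>p. (LINT t|lborel. f (fst p, t) * indicator {..snd p} t) * Q (fst p) (snd p)"] PQ
    by (simp add: lborel_prod Q_def)
  also have "\<dots> = (LINT x|lborel. LINT t|lborel. f (x, t) * K (x, t))"
  proof (rule integral_cong_AE)
    have "(\<lambda>p. (LINT t|lborel. f (fst p, t) * indicator {..snd p} t) * Q (fst p) (snd p)) \<in> borel_measurable (lborel \<Otimes>\<^sub>M lborel)"
      using PQ unfolding Q_def lborel_prod by auto
    from lborel.borel_measurable_lebesgue_integral[of "\<lambda>x y. (LINT t|lborel. f (x, t) * indicator {..y} t) * Q x y" lborel] this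
    show "(\<lambda>x. LINT y|lborel. (LINT t|lborel. f (x, t) * indicator {..y} t) * Q x y) \<in> borel_measurable lborel"
      by (simp add: case_prod_beta')
    show "(\<lambda>x. LINT t|lborel. f (x, t) * K (x, t)) \<in> borel_measurable lborel"
      using lborel_pair.integrable_fst'[OF intK] by auto
    show "AE x in lborel. (LINT y|lborel. (LINT t|lborel. f (x, t) * indicator {..y} t) * Q x y)
        = (LINT t|lborel. f (x, t) * K (x, t))"
      using lborel_pair.AE_integrable_fst'[OF int2]
    proof eventually_elim
      case (elim x)
      have "integrable (lborel \<Otimes>\<^sub>M lborel) (\<lambda>(t, y). f (x, t) * Q x y * (\<lambda>z. indicator {z. fst z \<le> snd z} z) (t, y))"
        by (rule integrable_product_kernel[OF _ _ elim Qint])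
          (auto intro: lborel.sigma_finite_measure_axioms simp: indicator_def)
      then have i: "integrable (lborel \<Otimes>\<^sub>M lborel) (\<lambda>(t, y). f (x, t) * Q x y * indicator {t..} y)"
        by (rule Bochner_Integration.integrable_cong[THEN iffD1, rotated 2]) (auto simp: indicator_def)
      have "(LINT y|lborel. (LINT t|lborel. f (x, t) * indicator {..y} t) * Q x y)
         = (LINT y|lborel. LINT t|lborel. f (x, t) * Q x y * indicator {t..} y)"
        by (subst integral_mult_left_zero[symmetric], intro Bochner_Integration.integral_cong)
          (auto simp: indicator_def)
      also have "\<dots> = (LINT t|lborel. LINT y|lborel. f (x, t) * Q x y * indicator {t..} y)"
        by (rule lborel_pair.Fubini_integral[OF i])
      also have "\<dots> = (LINT t|lborel. f (x, t) * K (x, t))"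
        by (simp add: K mult.assoc)
      finally show ?case .
    qed
  qed
  also have "\<dots> = (LINT p|lborel. f p * K p)"
    using lborel_pair.integral_fst'[OF intK] by (simp add: lborel_prod)
  also have "\<dots> = concordance f f"
    unfolding concordance_def K_def by (simp add: mult.assoc)
  finally show ?thesis unfolding Q_def .
qed

text \<open>
  Both descriptions of the energy integrand agree almost everywhere: the derivatives of \<open>h\<close> are \<open>- P\<close> and \<open>Q\<close>,
  with \<open>0 \<le> P, Q \<le> 1\<close>, so that \<open>P Q\<close> is integrable and the integral may be split.
\<close>

theorem permuton_energy_eq_concordance:
  assumes f: "permuton_pdf \<mu> f" and h: "permuton_of h \<mu>"
  shows "permuton_energy r h = (if integrable lborel (\<lambda>p. f p * ln (f p))
     then ereal (r * concordance f f - (LINT p|lborel. f p * ln (f p))) else - \<infinity>)"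
proof -
  note D = permuton_pdfD[OF f]
  note [measurable] = D(2)
  define P where "P p = (LINT t|lborel. f (fst p, t) * indicator {..snd p} t)" for p
  define Q where "Q p = (LINT s|lborel. f (s, snd p) * indicator {fst p<..} s)" for p
  have ac: "absolutely_continuous lborel \<mu>"
    unfolding D(5) by (rule absolutely_continuousI_density) simp
  have the: "(THE \<mu>. permuton_of h \<mu>) = \<mu>"
    using h permuton_of_unique by blast
  define g where "g = permuton_density \<mu>"
  have gm [measurable]: "g \<in> borel_measurable borel"
  proof -
    have "(\<lambda>p. enn2real (RN_deriv lborel \<mu> p)) \<in> borel_measurable lborel" by measurable
    then show ?thesis by (simp add: g_def permuton_density_def[abs_def])
  qed
  have "AE p in lborel. ennreal (f p) = RN_deriv lborel \<mu> p"
    using D(5) by (intro sigma_finite_measure.RN_deriv_unique[OF lborel.sigma_finite_measure_axioms]) (auto simp: D(5)[symmetric])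
  then have gf: "AE p in lborel. g p = f p"
    unfolding g_def permuton_density_def by eventually_elim (metis D(3) enn2real_ennreal)
  have sI: "set_integrable lebesgue unit_square (\<lambda>p. g p * ln (g p)) \<longleftrightarrow> integrable lborel (\<lambda>p. f p * ln (f p))"
  proof -
    have "set_integrable lebesgue unit_square (\<lambda>p. g p * ln (g p))
       \<longleftrightarrow> integrable lborel (\<lambda>p. indicator unit_square p *\<^sub>R (g p * ln (g p)))"
      unfolding set_integrable_def
      by (subst integrable_completion) simp_all
    also have "\<dots> \<longleftrightarrow> integrable lborel (\<lambda>p. f p * ln (f p))"
    proof (rule integrable_cong_AE)
      show "AE p in lborel. indicator unit_square p *\<^sub>R (g p * ln (g p)) = f p * ln (f p)"
        using gf by eventually_elim (use D(4) in \<open>auto split: split_indicator\<close>)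
    qed simp_all
    finally show ?thesis .
  qed
  show ?thesis
  proof (cases "integrable lborel (\<lambda>p. f p * ln (f p))")
    case True
    have P0: "P p = 0" if "fst p \<notin> {0<..<1}" for p
    proof -
      have "f (fst p, t) = 0" for t using that D(4)[of "(fst p, t)"] by auto
      then show ?thesis by (simp add: P_def)
    qed
    have Q0: "Q p = 0" if "snd p \<notin> {0<..<1}" for p
    proof -
      have "f (s, snd p) = 0" for s using that D(4)[of "(s, snd p)"] by auto
      then show ?thesis by (simp add: Q_def)
    qed
    have Pm [measurable]: "P \<in> borel_measurable borel"
    proof -
      have "(\<lambda>p. LINT t|lborel. f (fst p, t) * (if t \<le> snd p then 1 else 0)) \<in> borel_measurable (borel \<Otimes>\<^sub>M borel)"
        by measurable
      moreover have "P = (\<lambda>p. LINT t|lborel. f (fst p, t) * (if t \<le> snd p then 1 else 0))"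
        unfolding P_def by (auto simp: indicator_def intro!: Bochner_Integration.integral_cong)
      ultimately show ?thesis by (simp add: borel_prod)
    qed
    have Qm [measurable]: "Q \<in> borel_measurable borel"
    proof -
      have "(\<lambda>p. LINT s|lborel. f (s, snd p) * (if fst p < s then 1 else 0)) \<in> borel_measurable (borel \<Otimes>\<^sub>M borel)"
        by measurable
      moreover have "Q = (\<lambda>p. LINT s|lborel. f (s, snd p) * (if fst p < s then 1 else 0))"
        unfolding Q_def by (auto simp: indicator_def intro!: Bochner_Integration.integral_cong)
      ultimately show ?thesis by (simp add: borel_prod)
    qed
    have der: "AE p in lborel. p \<in> unit_square \<longrightarrow>
      deriv (\<lambda>s. h s (snd p)) (fst p) = - P p \<and> deriv (\<lambda>t. h (fst p) t) (snd p) = Q p \<and>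
      0 \<le> P p \<and> P p \<le> 1 \<and> 0 \<le> Q p \<and> Q p \<le> 1"
      using permuton_pdf_partial_derivatives[OF f h] unfolding P_def Q_def .
    have PQ: "integrable lborel (\<lambda>p. P p * Q p)"
    proof (rule Bochner_Integration.integrable_bound)
      show "integrable lborel (indicator unit_square :: real \<times> real \<Rightarrow> real)"
        by (rule integrable_indicator_unit_square)
      show "AE p in lborel. norm (P p * Q p) \<le> norm (indicator unit_square p :: real)"
        using der
      proof eventually_elim
        case (elim p)
        show ?case
        proof (cases "p \<in> unit_square")
          case True
          with elim show ?thesis by (auto simp: abs_mult intro!: mult_le_one)
        next
          case False
          then show ?thesis using P0[of p] Q0[of p] by (auto simp: mem_Times_iff)
        qed
      qed
    qed simp
    have conc: "(LINT p|lborel. P p * Q p) = concordance f f"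
      using concordance_eq_integral_of_marginals[OF permuton_pdf_integrable[OF f]] PQ
      by (simp add: P_def Q_def)
    let ?e = "\<lambda>p. r * (P p * Q p) - f p * ln (f p)"
    have eq: "AE p in lborel. ?e p = indicator unit_square p *\<^sub>R (- g p * ln (g p)
               - r * deriv (\<lambda>s. h s (snd p)) (fst p) * deriv (\<lambda>t. h (fst p) t) (snd p))"
      using der gf
    proof eventually_elim
      case (elim p)
      show ?case
      proof (cases "p \<in> unit_square")
        case True
        with elim show ?thesis by simp
      next
        case False
        then show ?thesis using P0[of p] Q0[of p] D(4)[of p] by (auto simp: mem_Times_iff)
      qed
    qed
    have "(LINT p:unit_square|lebesgue. - g p * ln (g p)
               - r * deriv (\<lambda>s. h s (snd p)) (fst p) * deriv (\<lambda>t. h (fst p) t) (snd p))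
        = (LINT p|lborel. ?e p)"
      unfolding set_lebesgue_integral_def
    proof (rule integral_lebesgue_eq_lborel)
      show "AE p in lborel. indicator unit_square p *\<^sub>R (- g p * ln (g p)
               - r * deriv (\<lambda>s. h s (snd p)) (fst p) * deriv (\<lambda>t. h (fst p) t) (snd p)) = ?e p"
        using eq by eventually_elim simp
    qed simp
    also have "\<dots> = r * concordance f f - (LINT p|lborel. f p * ln (f p))"
      using PQ True conc by (subst Bochner_Integration.integral_diff) auto
    finally show ?thesis
      unfolding permuton_energy_def using h ac True sI by (auto simp: Let_def the g_def)
  next
    case False
    then show ?thesis
      unfolding permuton_energy_def using sI by (auto simp: Let_def the g_def)
  qed
qed

section \<open>Competitors given by densities\<close>

lemma measure_lborel_Times:
  fixes A B :: "real set"
  assumes "A \<in> sets borel" "B \<in> sets borel"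
  shows "measure lborel (A \<times> B) = measure lborel A * measure lborel B"
  using assms by (simp add: measure_def lborel.emeasure_pair_measure_Times enn2real_mult flip: lborel_prod)

lemma permuton_pdfI:
  assumes f: "f \<in> borel_measurable borel" "\<And>p. 0 \<le> f p" "\<And>p. p \<notin> unit_square \<Longrightarrow> f p = 0"
    and int: "integrable lborel f"
    and m1: "\<And>A. A \<in> sets borel \<Longrightarrow> (LINT p|lborel. f p * indicator (A \<times> UNIV) p) = measure lborel (A \<inter> {0..1})"
    and m2: "\<And>A. A \<in> sets borel \<Longrightarrow> (LINT p|lborel. f p * indicator (UNIV \<times> A) p) = measure lborel (A \<inter> {0..1})"
  shows "permuton_pdf (density lborel (\<lambda>p. ennreal (f p))) f"
proof -
  define \<mu> where "\<mu> = density lborel (\<lambda>p. ennreal (f p))"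
  note [measurable] = f(1)
  have sets: "sets \<mu> = sets borel" and space: "space \<mu> = UNIV" by (simp_all add: \<mu>_def)
  have em: "emeasure \<mu> S = ennreal (LINT p|lborel. f p * indicator S p)" if S: "S \<in> sets borel" for S
  proof -
    have "emeasure \<mu> S = (\<integral>\<^sup>+ p. ennreal (f p * indicator S p) \<partial>lborel)"
      using S f by (auto simp: \<mu>_def emeasure_density intro!: nn_integral_cong split: split_indicator)
    also have "\<dots> = ennreal (LINT p|lborel. f p * indicator S p)"
      using S f int by (intro nn_integral_eq_integral integrable_mult_indicator_real) auto
    finally show ?thesis .
  qed
  have fin: "ennreal (measure lborel (A \<inter> {0..1::real})) = emeasure lborel (A \<inter> {0..1})" if "A \<in> sets borel" for A
  proof -
    have "emeasure lborel (A \<inter> {0..1}) \<le> emeasure lborel {0..1::real}" by (rule emeasure_mono) auto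
    then have "emeasure lborel (A \<inter> {0..1}) \<noteq> \<infinity>" by (auto simp: top_unique)
    then show ?thesis by (simp add: emeasure_eq_ennreal_measure)
  qed
  have "emeasure \<mu> (space \<mu>) = emeasure \<mu> (UNIV \<times> UNIV)" by (simp add: space)
  also have "\<dots> = 1" using em[of "UNIV \<times> UNIV"] m1[of UNIV] by simp
  finally have "prob_space \<mu>" by (rule prob_spaceI)
  moreover have "distr \<mu> borel fst = uniform_measure lborel {0..1}"
  proof (rule measure_eqI)
    fix A assume "A \<in> sets (distr \<mu> borel fst)"
    then have A: "A \<in> sets borel" by simp
    have "fst \<in> borel_measurable \<mu>"
      by (simp add: \<mu>_def borel_measurable_continuous_onI continuous_on_fst continuous_on_id)
    moreover have "fst -` A \<inter> space \<mu> = A \<times> UNIV" by (auto simp: space)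
    ultimately have "emeasure (distr \<mu> borel fst) A = emeasure \<mu> (A \<times> UNIV)"
      using A by (simp add: emeasure_distr)
    then show "emeasure (distr \<mu> borel fst) A = emeasure (uniform_measure lborel {0..1}) A"
      using A em[of "A \<times> UNIV"] m1[OF A] fin[OF A] by (simp add: borel_Times Int_commute divide_ennreal_def)
  qed simp
  moreover have "distr \<mu> borel snd = uniform_measure lborel {0..1}"
  proof (rule measure_eqI)
    fix A assume "A \<in> sets (distr \<mu> borel snd)"
    then have A: "A \<in> sets borel" by simp
    have "snd \<in> borel_measurable \<mu>"
      by (simp add: \<mu>_def borel_measurable_continuous_onI continuous_on_snd continuous_on_id)
    moreover have "snd -` A \<inter> space \<mu> = UNIV \<times> A" by (auto simp: space)
    ultimately have "emeasure (distr \<mu> borel snd) A = emeasure \<mu> (UNIV \<times> A)"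
      using A by (simp add: emeasure_distr)
    then show "emeasure (distr \<mu> borel snd) A = emeasure (uniform_measure lborel {0..1}) A"
      using A em[of "UNIV \<times> A"] m2[OF A] fin[OF A] by (simp add: borel_Times Int_commute divide_ennreal_def)
  qed simp
  ultimately show ?thesis
    unfolding permuton_pdf_def \<mu>_def[symmetric] permuton_def using f sets by (auto simp: \<mu>_def)
qed

lemma permuton_pdf_marginals:
  assumes f: "permuton_pdf \<mu> f" and A: "A \<in> sets borel"
  shows "(LINT p|lborel. f p * indicator (A \<times> UNIV) p) = measure lborel (A \<inter> {0..1})"
    "(LINT p|lborel. f p * indicator (UNIV \<times> A) p) = measure lborel (A \<inter> {0..1})"
  using permuton_emeasure_vertical_strip[OF permuton_pdfD(1)[OF f] A]
    permuton_emeasure_horizontal_strip[OF permuton_pdfD(1)[OF f] A]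
    permuton_pdf_measure[OF f, of "A \<times> UNIV"] permuton_pdf_measure[OF f, of "UNIV \<times> A"] A
  by (simp_all add: measure_def borel_Times)

lemma permuton_pdf_of_absolutely_continuous:
  assumes \<mu>: "permuton \<mu>" and ac: "absolutely_continuous lborel \<mu>"
  shows "permuton_pdf \<mu> (\<lambda>p. if p \<in> unit_square then permuton_density \<mu> p else 0)"
proof -
  let ?f = "\<lambda>p. if p \<in> unit_square then permuton_density \<mu> p else 0"
  interpret prob_space \<mu> using \<mu> by (simp add: permuton_def)
  have sets: "sets \<mu> = sets borel" using \<mu> by (simp add: permuton_def)
  note sf = lborel.sigma_finite_measure_axioms
  have dens: "density lborel (RN_deriv lborel \<mu>) = \<mu>"
    using ac sets by (intro sigma_finite_measure.density_RN_deriv[OF sf]) simp_all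
  have rn [measurable]: "RN_deriv lborel \<mu> \<in> borel_measurable borel"
    using borel_measurable_RN_deriv[of lborel \<mu>] by simp
  have pm [measurable]: "permuton_density \<mu> \<in> borel_measurable borel"
    unfolding permuton_density_def[abs_def] by measurable
  have fin: "AE p in lborel. RN_deriv lborel \<mu> p \<noteq> \<infinity>"
    using ac sets by (intro sigma_finite_measure.RN_deriv_finite[OF sf]) (auto intro: sigma_finite_measure_axioms)
  have "emeasure \<mu> (- unit_square) = 0"
  proof (rule AE_iff_measurable[THEN iffD1, OF _ _ permuton_AE_unit_square[OF \<mu>]])
    show "- unit_square \<in> events" by (simp add: sets)
  qed (use permuton_space[OF \<mu>] in auto)
  then have "(\<integral>\<^sup>+ p. RN_deriv lborel \<mu> p * indicator (- unit_square) p \<partial>lborel) = 0"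
    by (subst (asm) dens[symmetric]) (simp add: emeasure_density)
  then have off: "AE p in lborel. RN_deriv lborel \<mu> p * indicator (- unit_square) p = 0"
    by (subst (asm) nn_integral_0_iff_AE) auto
  have "density lborel (\<lambda>p. ennreal (?f p)) = density lborel (RN_deriv lborel \<mu>)"
  proof (rule density_cong)
    show "AE p in lborel. ennreal (?f p) = RN_deriv lborel \<mu> p"
      using fin off
    proof eventually_elim
      case (elim p)
      then show ?case by (cases "p \<in> unit_square") (auto simp: permuton_density_def less_top)
    qed
  qed (simp_all add: permuton_density_def)
  then show ?thesis
    unfolding permuton_pdf_def using \<mu> dens by (auto simp: permuton_density_def intro!: measurable_If_set pm)
qed

lemma permuton_pdf_cong_AE:
  assumes f: "permuton_pdf \<mu> f" and ae: "AE p in lborel. f' p = f p"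
    and f': "f' \<in> borel_measurable borel" "\<And>p. 0 \<le> f' p" "\<And>p. p \<notin> unit_square \<Longrightarrow> f' p = 0"
  shows "permuton_pdf \<mu> f'"
proof -
  have "density lborel (\<lambda>p. ennreal (f' p)) = density lborel (\<lambda>p. ennreal (f p))"
    using ae f' permuton_pdfD(2)[OF f] by (intro density_cong) auto
  then have "\<mu> = density lborel (\<lambda>p. ennreal (f' p))" using permuton_pdfD(5)[OF f] by simp
  then show ?thesis using permuton_pdfD(1)[OF f] f' unfolding permuton_pdf_def by blast
qed

lemma grid_bounds:
  fixes xs :: "nat \<Rightarrow> real"
  assumes "xs 0 = 0" "xs k = 1" "strict_mono_on {0..k} xs" "u \<in> {1..k}"
  shows "0 \<le> xs (u - 1)" "xs (u - 1) < xs u" "xs u \<le> 1"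
proof -
  have m: "xs a \<le> xs b" if "a \<le> b" "b \<le> k" for a b
    using strict_mono_onD[OF assms(3), of a b] that by (cases "a = b") auto
  show "xs (u - 1) < xs u" using strict_mono_onD[OF assms(3), of "u - 1" u] assms by auto
  show "0 \<le> xs (u - 1)" "xs u \<le> 1" using m[of 0 "u - 1"] m[of u k] assms by auto
qed

text \<open>
  The four-point combination of \<open>h\<close> in the constraint is minus the mass of the rectangle. In this form the
  constraint is linear in the density.
\<close>

lemma class_F_xyI_iff_forbidden_mass:
  assumes f: "permuton_pdf \<mu> f" and h: "permuton_of h \<mu>" and hF: "h \<in> class_F"
    and xs: "xs 0 = 0" "xs k = 1" "strict_mono_on {0..k} xs"
    and ys: "ys 0 = 0" "ys l = 1" "strict_mono_on {0..l} ys"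
  shows "h \<in> class_F_xyI k l xs ys I \<longleftrightarrow> (\<forall>u\<in>{1..k}. \<forall>v\<in>{1..l}. I u v = 0 \<longrightarrow>
     (LINT p|lborel. f p * indicator ({xs (u - 1)..xs u} \<times> {ys (v - 1)..ys v}) p) = 0)"
proof -
  have eq: "h (xs u) (ys v) + h (xs (u - 1)) (ys (v - 1)) - h (xs u) (ys (v - 1)) - h (xs (u - 1)) (ys v)
      = - (LINT p|lborel. f p * indicator ({xs (u - 1)..xs u} \<times> {ys (v - 1)..ys v}) p)"
    if "u \<in> {1..k}" "v \<in> {1..l}" for u v
  proof -
    note b = grid_bounds[OF xs that(1)] grid_bounds[OF ys that(2)]
    have "h a c = measure \<mu> ({a..1} \<times> {0..c})" if "a \<in> {xs (u - 1), xs u}" "c \<in> {ys (v - 1), ys v}" for a c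
      using h that b unfolding permuton_of_def by auto
    then show ?thesis
      using permuton_rectangle[OF permuton_pdfD(1)[OF f], of "xs (u - 1)" "xs u" "ys (v - 1)" "ys v"] b
        permuton_pdf_measure[OF f, of "{xs (u - 1)..xs u} \<times> {ys (v - 1)..ys v}"]
      by (simp add: borel_Times)
  qed
  have iff: "h (xs u) (ys v) + h (xs (u - 1)) (ys (v - 1)) - h (xs u) (ys (v - 1)) - h (xs (u - 1)) (ys v) = 0
      \<longleftrightarrow> (LINT p|lborel. f p * indicator ({xs (u - 1)..xs u} \<times> {ys (v - 1)..ys v}) p) = 0"
    if "u \<in> {1..k}" "v \<in> {1..l}" for u v
    using eq[OF that] by simp
  have "h \<in> class_F_xyI k l xs ys I \<longleftrightarrow> (\<forall>u\<in>{1..k}. \<forall>v\<in>{1..l}. I u v = 0 \<longrightarrow>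
     h (xs u) (ys v) + h (xs (u - 1)) (ys (v - 1)) - h (xs u) (ys (v - 1)) - h (xs (u - 1)) (ys v) = 0)"
    using hF unfolding class_F_xyI_def by blast
  also have "\<dots> \<longleftrightarrow> (\<forall>u\<in>{1..k}. \<forall>v\<in>{1..l}. I u v = 0 \<longrightarrow>
     (LINT p|lborel. f p * indicator ({xs (u - 1)..xs u} \<times> {ys (v - 1)..ys v}) p) = 0)"
    by (intro ball_cong refl imp_cong iff)
  finally show ?thesis .
qed

lemma permuton_of_canonical: "permuton \<mu> \<Longrightarrow> permuton_of (\<lambda>x y. measure \<mu> ({x..1} \<times> {0..y})) \<mu>"
  by (simp add: permuton_of_def)

section \<open>The first-order condition\<close>

lemma concordance_pair:
  assumes f: "integrable lborel f" and g: "integrable lborel g"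
  defines "k \<equiv> \<lambda>z. f (fst z) * g (snd z) * indicator (north_east (fst z)) (snd z)"
  shows "integrable (lborel \<Otimes>\<^sub>M lborel) k" "concordance f g = (LINT z|(lborel \<Otimes>\<^sub>M lborel). k z)"
    "concordance f g = (LINT q|lborel. LINT p|lborel. f p * g q * indicator (north_east p) q)"
proof -
  have "integrable (lborel \<Otimes>\<^sub>M lborel) (\<lambda>(p, q). f p * g q * (\<lambda>z. indicator (north_east (fst z)) (snd z)) (p, q))"
    by (rule integrable_product_kernel[OF _ _ f g borel_measurable_north_east])
      (auto intro: lborel.sigma_finite_measure_axioms simp: indicator_def)
  then have i: "integrable (lborel \<Otimes>\<^sub>M lborel) (\<lambda>(p, q). f p * g q * indicator (north_east p) q)" by simp
  then show "integrable (lborel \<Otimes>\<^sub>M lborel) k" by (simp add: k_def case_prod_beta')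
  show "concordance f g = (LINT z|(lborel \<Otimes>\<^sub>M lborel). k z)"
    unfolding concordance_def k_def using lborel_pair.integral_fst[OF i] by (simp add: case_prod_beta')
  show "concordance f g = (LINT q|lborel. LINT p|lborel. f p * g q * indicator (north_east p) q)"
    unfolding concordance_def by (rule lborel_pair.Fubini_integral[OF i, symmetric])
qed

lemma concordance_perturb:
  assumes f: "integrable lborel f" and g: "integrable lborel g"
  shows "concordance (\<lambda>p. f p + d * g p) (\<lambda>p. f p + d * g p)
     = concordance f f + d * (concordance f g + concordance g f) + d^2 * concordance g g"
proof -
  have fg: "integrable lborel (\<lambda>p. f p + d * g p)" using f g by simp
  note c = concordance_pair
  have "concordance (\<lambda>p. f p + d * g p) (\<lambda>p. f p + d * g p)
    = (LINT z|(lborel \<Otimes>\<^sub>M lborel). f (fst z) * f (snd z) * indicator (north_east (fst z)) (snd z)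
       + d * (f (fst z) * g (snd z) * indicator (north_east (fst z)) (snd z)
          + g (fst z) * f (snd z) * indicator (north_east (fst z)) (snd z))
       + d^2 * (g (fst z) * g (snd z) * indicator (north_east (fst z)) (snd z)))"
    unfolding c(2)[OF fg fg]
    by (rule Bochner_Integration.integral_cong) (auto simp: algebra_simps power2_eq_square)
  also have "\<dots> = concordance f f + d * (concordance f g + concordance g f) + d^2 * concordance g g"
    unfolding c(2)[OF f f] c(2)[OF f g] c(2)[OF g f] c(2)[OF g g]
    using c(1)[OF f f] c(1)[OF f g] c(1)[OF g f] c(1)[OF g g] by simp
  finally show ?thesis .
qed

text \<open>
  By Fubini the two mixed terms weigh \<open>\<phi>\<close> by the masses \<open>1 - x - h(x,y)\<close> and \<open>y - h(x,y)\<close> of the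
  north-east and the south-west quadrant of a point.
\<close>

lemma concordance_first_variation:
  assumes f: "permuton_pdf \<mu> f" and h: "permuton_of h \<mu>"
    and \<phi>: "integrable lborel \<phi>" "\<And>p. p \<notin> unit_square \<Longrightarrow> \<phi> p = 0"
  shows "integrable lborel (\<lambda>p. \<phi> p * (1 - fst p + snd p - 2 * h (fst p) (snd p)))" (is ?I)
    "concordance f \<phi> + concordance \<phi> f = (LINT p|lborel. \<phi> p * (1 - fst p + snd p - 2 * h (fst p) (snd p)))" (is ?E)
proof -
  note D = permuton_pdfD[OF f]
  note int = permuton_pdf_integrable[OF f]
  have a: "\<phi> q * (LINT p|lborel. f p * indicator (north_east p) q) = \<phi> q * (snd q - h (fst q) (snd q))" for q
  proof (cases "q \<in> unit_square")
    case True
    then obtain x y where q: "q = (x, y)" "0 < x" "x < 1" "0 < y" "y < 1" by (cases q) auto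
    have "(LINT p|lborel. f p * indicator (north_east p) q) = (LINT p|lborel. f p * indicator ({..<x} \<times> {..y}) p)"
      by (rule Bochner_Integration.integral_cong) (auto simp: q north_east_def indicator_def)
    also have "\<dots> = measure \<mu> ({..<x} \<times> {..y})" by (rule permuton_pdf_measure[OF f, symmetric]) (simp add: borel_Times)
    also have "\<dots> = measure \<mu> ({..x} \<times> {..y})"
      by (rule permuton_measure_cong[OF D(1), where a = x]) (auto simp: borel_Times)
    also have "\<dots> = y - h x y"
      using permuton_measure_lower_left[OF D(1), of x y] h q by (simp add: permuton_of_def)
    finally show ?thesis by (simp add: q)
  qed (simp add: \<phi>)
  have b: "\<phi> p * (LINT q|lborel. f q * indicator (north_east p) q) = \<phi> p * (1 - fst p - h (fst p) (snd p))" for p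
  proof (cases "p \<in> unit_square")
    case True
    then obtain x y where p: "p = (x, y)" "0 < x" "x < 1" "0 < y" "y < 1" by (cases p) auto
    have "(LINT q|lborel. f q * indicator (north_east p) q) = measure \<mu> ({x<..} \<times> {y..})"
      unfolding p north_east_def fst_conv snd_conv
      by (rule permuton_pdf_measure[OF f, symmetric]) (simp add: borel_Times)
    also have "\<dots> = measure \<mu> ({x..1} \<times> {y..1})"
      by (rule permuton_measure_cong[OF D(1), where a = x]) (auto simp: borel_Times)
    also have "\<dots> = 1 - x - h x y"
      using permuton_rectangle[OF D(1), of x 1 y 1] permuton_in_class_F[OF D(1)] h p
      by (auto simp: class_F_def permuton_of_def)
    finally show ?thesis by (simp add: p)
  qed (simp add: \<phi>)
  note c1 = concordance_pair[OF int \<phi>(1)] and c2 = concordance_pair[OF \<phi>(1) int]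
  have e1: "(LINT p|lborel. f p * \<phi> q * indicator (north_east p) q) = \<phi> q * (snd q - h (fst q) (snd q))" for q
    using a[of q] by (simp add: mult_ac flip: integral_mult_right_zero)
  have e2: "(LINT q|lborel. \<phi> p * f q * indicator (north_east p) q) = \<phi> p * (1 - fst p - h (fst p) (snd p))" for p
    using b[of p] by (simp add: mult_ac flip: integral_mult_right_zero)
  have i1: "integrable lborel (\<lambda>q. \<phi> q * (snd q - h (fst q) (snd q)))"
    using lborel_pair.integrable_snd[of "\<lambda>p q. f p * \<phi> q * indicator (north_east p) q"] c1(1) e1 by (simp add: case_prod_beta')
  have i2: "integrable lborel (\<lambda>p. \<phi> p * (1 - fst p - h (fst p) (snd p)))"
    using lborel_pair.integrable_fst[of "\<lambda>p q. \<phi> p * f q * indicator (north_east p) q"] c2(1) e2 by (simp add: case_prod_beta')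
  have eq: "\<phi> p * (1 - fst p + snd p - 2 * h (fst p) (snd p))
     = \<phi> p * (snd p - h (fst p) (snd p)) + \<phi> p * (1 - fst p - h (fst p) (snd p))" for p
    by (simp add: algebra_simps)
  show ?I unfolding eq using i1 i2 by simp
  show ?E unfolding eq using i1 i2 c1(3) c2(3) e1 e2 by (simp add: concordance_def)
qed

text \<open>
  A one-sided second-order bound suffices, because maximality is used in one direction only; it follows from
  \<open>ln (1 + w / u) \<le> w / u\<close> and spares any differentiation under the integral.
\<close>

lemma xlnx_perturb_le:
  fixes u w :: real
  assumes "0 < u" "0 < u + w"
  shows "(u + w) * ln (u + w) \<le> u * ln u + w * (ln u + 1) + w\<^sup>2 / u"
proof -
  have "-1 < w / u" using assms by (simp add: field_simps)
  then have "ln (1 + w / u) \<le> w / u" by (rule ln_add_one_self_le_self2)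
  moreover have "ln (u + w) = ln u + ln (1 + w / u)"
  proof -
    have "u + w = u * (1 + w / u)" using assms by (simp add: field_simps)
    moreover have "0 < 1 + w / u" using assms by (simp add: field_simps)
    ultimately show ?thesis using assms by (metis ln_mult_pos)
  qed
  ultimately have "ln (u + w) \<le> ln u + w / u" by simp
  then have "(u + w) * ln (u + w) \<le> (u + w) * (ln u + w / u)"
    using assms by (intro mult_left_mono) auto
  also have "\<dots> = u * ln u + w * (ln u + 1) + w\<^sup>2 / u"
    using assms by (simp add: field_simps power2_eq_square)
  finally show ?thesis .
qed

lemma abs_ln_le: "0 < (u::real) \<Longrightarrow> \<bar>ln u\<bar> \<le> u + 1 / u"
  using ln_le_minus_one[of u] ln_le_minus_one[of "1 / u"] by (simp add: ln_div abs_le_iff)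
    (smt (verit) divide_pos_pos)

lemma abs_xlnx_le: "0 \<le> (u::real) \<Longrightarrow> \<bar>u * ln u\<bar> \<le> u\<^sup>2 + 1"
proof (cases "u = 0")
  case False
  assume "0 \<le> u"
  with False have u: "0 < u" by simp
  then have "u * \<bar>ln u\<bar> \<le> u * (u + 1 / u)" by (intro mult_left_mono abs_ln_le) auto
  moreover have "u * (u + 1 / u) = u\<^sup>2 + 1" using u by (simp add: field_simps power2_eq_square)
  ultimately show ?thesis using u by (simp add: abs_mult)
qed simp

lemma linear_coefficient_zero:
  fixes a b d0 :: real
  assumes "0 < d0" and le: "\<And>d. \<bar>d\<bar> \<le> d0 \<Longrightarrow> d * a + d\<^sup>2 * b \<le> 0"
  shows "a = 0"
proof (rule ccontr)
  assume a: "a \<noteq> 0"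
  \<comment> \<open>Small enough for the quadratic term to be at most half the linear one.\<close>
  define t where "t = min d0 (\<bar>a\<bar> / (2 * (\<bar>b\<bar> + 1)))"
  have t: "0 < t" "t \<le> d0" "t \<le> \<bar>a\<bar> / (2 * (\<bar>b\<bar> + 1))" using a assms by (auto simp: t_def)
  have "(sgn a * t) * a + (sgn a * t)\<^sup>2 * b \<le> 0"
    using t a by (intro le) (auto simp: abs_mult sgn_if)
  then have "t * (\<bar>a\<bar> + t * b) \<le> 0"
    using a by (auto simp: sgn_if power2_eq_square algebra_simps split: if_splits)
  then have "\<bar>a\<bar> + t * b \<le> 0" using t by (simp add: mult_le_0_iff)
  moreover have "t * \<bar>b\<bar> \<le> \<bar>a\<bar> / (2 * (\<bar>b\<bar> + 1)) * \<bar>b\<bar>" using t by (intro mult_right_mono) auto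
  moreover have "\<bar>a\<bar> / (2 * (\<bar>b\<bar> + 1)) * \<bar>b\<bar> \<le> \<bar>a\<bar> / 2"
    by (simp add: field_simps)
  moreover have "- (t * \<bar>b\<bar>) \<le> t * b" using t by (auto simp: abs_if mult_nonneg_nonneg split: if_splits)
  ultimately show False using a by linarith
qed

text \<open>
  For \<open>\<bar>d\<bar> \<le> min (c / 2) 1\<close> the function \<open>f + d \<phi>\<close> is the density of a competitor, and comparing energies gives
  \<open>d a + d\<^sup>2 b \<le> 0\<close>, where \<open>a\<close> is \<open>r\<close> times the first variation of the concordance minus
  \<open>\<integral> \<phi> ln f\<close>. Both signs of \<open>d\<close> are allowed, hence \<open>a = 0\<close>. The term \<open>\<integral> \<phi>\<close> from the derivative
  \<open>ln f + 1\<close> of the entropy integrand vanishes with the marginals.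
\<close>

lemma first_order_condition:
  assumes xs: "xs 0 = 0" "xs k = 1" "strict_mono_on {0..k} xs"
    and ys: "ys 0 = 0" "ys l = 1" "strict_mono_on {0..l} ys"
    and max: "is_arg_max (permuton_energy r) (\<lambda>h'. h' \<in> class_F_xyI k l xs ys I) h"
    and h: "permuton_of h \<mu>" and f: "permuton_pdf \<mu> f"
    and ent: "integrable lborel (\<lambda>p. f p * ln (f p))"
    and \<phi>: "\<phi> \<in> borel_measurable borel" "\<And>p. \<bar>\<phi> p\<bar> \<le> 1" "\<And>p. p \<notin> unit_square \<Longrightarrow> \<phi> p = 0"
    and bds: "0 < c" "\<And>p. \<phi> p \<noteq> 0 \<Longrightarrow> c \<le> f p \<and> f p \<le> C"
    and m1: "\<And>A. A \<in> sets borel \<Longrightarrow> (LINT p|lborel. \<phi> p * indicator (A \<times> UNIV) p) = 0"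
    and m2: "\<And>A. A \<in> sets borel \<Longrightarrow> (LINT p|lborel. \<phi> p * indicator (UNIV \<times> A) p) = 0"
    and forb: "\<And>u v. u \<in> {1..k} \<Longrightarrow> v \<in> {1..l} \<Longrightarrow> I u v = 0 \<Longrightarrow>
       (LINT p|lborel. \<phi> p * indicator ({xs (u - 1)..xs u} \<times> {ys (v - 1)..ys v}) p) = 0"
  shows "integrable lborel (\<lambda>p. \<phi> p * (ln (f p) - r * (1 - fst p + snd p - 2 * h (fst p) (snd p))))"
    "(LINT p|lborel. \<phi> p * (ln (f p) - r * (1 - fst p + snd p - 2 * h (fst p) (snd p)))) = 0"
proof -
  note D = permuton_pdfD[OF f]
  note int = permuton_pdf_integrable[OF f]
  note [measurable] = D(2) \<phi>(1)
  have \<phi>int: "integrable lborel \<phi>" by (rule integrable_bounded_on_unit_square[OF \<phi>])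
  have intS: "integrable lborel (\<lambda>p. f p * indicator S p)" "integrable lborel (\<lambda>p. \<phi> p * indicator S p)"
    if "S \<in> sets borel" for S
    using int \<phi>int that by (auto intro!: integrable_mult_indicator_real)
  have \<phi>ln: "integrable lborel (\<lambda>p. \<phi> p * ln (f p))"
  proof (rule integrable_bounded_on_unit_square)
    fix p show "\<bar>\<phi> p * ln (f p)\<bar> \<le> \<bar>C\<bar> + 1 / c"
    proof (cases "\<phi> p = 0")
      case False
      then have fp: "c \<le> f p" "f p \<le> C" using bds by auto
      have "\<bar>\<phi> p * ln (f p)\<bar> \<le> 1 * (f p + 1 / f p)"
        unfolding abs_mult using \<phi>(2) fp bds by (intro mult_mono abs_ln_le) auto
      also have "\<dots> \<le> \<bar>C\<bar> + 1 / c" using fp bds by (auto intro!: add_mono frac_le)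
      finally show ?thesis .
    qed (use bds in simp)
  qed (use \<phi> in auto)
  have \<phi>0: "(LINT p|lborel. \<phi> p) = 0" using m1[of UNIV] by simp
  define L where "L = concordance f \<phi> + concordance \<phi> f"
  define E where "E = (LINT p|lborel. f p * ln (f p))"
  define N where "N = (LINT p|lborel. \<bar>\<phi> p\<bar>)"
  have hmem: "h \<in> class_F_xyI k l xs ys I" using max by (simp add: is_arg_max_def)
  have key: "d * (r * L - (LINT p|lborel. \<phi> p * ln (f p))) + d\<^sup>2 * (r * concordance \<phi> \<phi> - N / c) \<le> 0"
    if d: "\<bar>d\<bar> \<le> min (c / 2) 1" for d
  proof -
    define F where "F p = f p + d * \<phi> p" for p
    have F_pos: "0 < F p" if "\<phi> p \<noteq> 0" for p
    proof -
      have "\<bar>d * \<phi> p\<bar> \<le> c / 2 * 1" unfolding abs_mult using d \<phi>(2)[of p] by (intro mult_mono) auto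
      then show ?thesis using bds(1) bds(2)[OF that] unfolding F_def by linarith
    qed
    have F0: "0 \<le> F p" for p
      using F_pos[of p] D(3)[of p] by (cases "\<phi> p = 0") (auto simp: F_def)
    have [measurable]: "F \<in> borel_measurable borel" unfolding F_def by measurable
    have Fint: "integrable lborel F" unfolding F_def using int \<phi>int by simp
    have FS: "(LINT p|lborel. F p * indicator S p) = (LINT p|lborel. f p * indicator S p) + d * (LINT p|lborel. \<phi> p * indicator S p)"
      if "S \<in> sets borel" for S
      using intS[OF that] by (simp add: F_def distrib_right mult.assoc)
    define \<nu> where "\<nu> = density lborel (\<lambda>p. ennreal (F p))"
    have F: "permuton_pdf \<nu> F"
      unfolding \<nu>_def
    proof (rule permuton_pdfI)
      show "F p = 0" if "p \<notin> unit_square" for p using that \<phi>(3) D(4) by (simp add: F_def)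
    qed (use F0 Fint FS m1 m2 permuton_pdf_marginals[OF f] in \<open>simp_all add: borel_Times\<close>)
    define h' where "h' = (\<lambda>x y. measure \<nu> ({x..1} \<times> {0..y}))"
    have h': "permuton_of h' \<nu>" "h' \<in> class_F"
      unfolding h'_def using permuton_pdfD(1)[OF F] by (simp_all add: permuton_of_canonical permuton_in_class_F)
    have hF: "h \<in> class_F" using hmem by (simp add: class_F_xyI_def)
    have "h' \<in> class_F_xyI k l xs ys I"
      unfolding class_F_xyI_iff_forbidden_mass[OF F h' xs ys]
      using hmem forb unfolding class_F_xyI_iff_forbidden_mass[OF f h hF xs ys] by (simp add: FS borel_Times)
    then have le: "permuton_energy r h' \<le> permuton_energy r h"
      using max by (auto simp: is_arg_max_def not_less)
    \<comment> \<open>An integrable majorant of the perturbed entropy integrand, from \<open>xlnx_perturb_le\<close> with \<open>\<phi>\<^sup>2 / f \<le> \<bar>\<phi>\<bar> / c\<close>.\<close>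
    define U where "U p = f p * ln (f p) + d * (\<phi> p * ln (f p) + \<phi> p) + d\<^sup>2 / c * \<bar>\<phi> p\<bar>" for p
    have Uint: "integrable lborel U" unfolding U_def using ent \<phi>ln \<phi>int by simp
    have FU: "F p * ln (F p) \<le> U p" for p
    proof (cases "\<phi> p = 0")
      case True then show ?thesis by (simp add: F_def U_def)
    next
      case False
      have fp: "c \<le> f p" using bds(2)[OF False] by simp
      have "F p * ln (F p) \<le> f p * ln (f p) + d * \<phi> p * (ln (f p) + 1) + (d * \<phi> p)\<^sup>2 / f p"
        unfolding F_def using F_pos[OF False] fp bds by (intro xlnx_perturb_le) (auto simp: F_def)
      also have "(d * \<phi> p)\<^sup>2 / f p \<le> d\<^sup>2 * \<bar>\<phi> p\<bar> / c"
      proof (rule frac_le)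
        have "\<bar>\<phi> p\<bar> * \<bar>\<phi> p\<bar> \<le> \<bar>\<phi> p\<bar>" using \<phi>(2)[of p] by (intro mult_left_le) auto
        then have "(\<phi> p)\<^sup>2 \<le> \<bar>\<phi> p\<bar>" by (simp add: power2_eq_square flip: abs_mult)
        then show "(d * \<phi> p)\<^sup>2 \<le> d\<^sup>2 * \<bar>\<phi> p\<bar>" by (simp add: power_mult_distrib mult_left_mono)
      qed (use bds fp in auto)
      finally show ?thesis by (simp add: U_def algebra_simps)
    qed
    have Fent: "integrable lborel (\<lambda>p. F p * ln (F p))"
    proof (rule Bochner_Integration.integrable_bound)
      let ?M = "(\<bar>C\<bar> + 1)\<^sup>2 + 1"
      show "integrable lborel (\<lambda>p. \<bar>f p * ln (f p)\<bar> + ?M * indicator unit_square p)"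
        using ent integrable_indicator_unit_square by simp
      show "AE p in lborel. norm (F p * ln (F p)) \<le> norm (\<bar>f p * ln (f p)\<bar> + ?M * indicator unit_square p)"
      proof (rule AE_I2)
        fix p
        have M0: "0 \<le> ?M" by simp
        show "norm (F p * ln (F p)) \<le> norm (\<bar>f p * ln (f p)\<bar> + ?M * indicator unit_square p)"
        proof (cases "\<phi> p = 0")
          case True then show ?thesis using M0 by (auto simp: F_def indicator_def)
        next
          case False
          then have pU: "p \<in> unit_square" using \<phi>(3) by blast
          have "\<bar>d * \<phi> p\<bar> \<le> 1 * 1" unfolding abs_mult using d \<phi>(2)[of p] by (intro mult_mono) auto
          then have "F p \<le> \<bar>C\<bar> + 1" using bds(2)[OF False] unfolding F_def by linarith
          then have "(F p)\<^sup>2 \<le> (\<bar>C\<bar> + 1)\<^sup>2" using F0 by (intro power_mono)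
          then have "\<bar>F p * ln (F p)\<bar> \<le> ?M" using abs_xlnx_le[OF F0[of p]] by linarith
          then show ?thesis using pU M0 by simp
        qed
      qed
    qed measurable
    have "r * concordance F F - (LINT p|lborel. F p * ln (F p)) \<le> r * concordance f f - E"
      using le unfolding permuton_energy_eq_concordance[OF F h'(1)] permuton_energy_eq_concordance[OF f h] E_def
      using Fent ent by simp
    moreover have "(LINT p|lborel. F p * ln (F p)) \<le> (LINT p|lborel. U p)"
      by (rule integral_mono[OF Fent Uint FU])
    moreover have "(LINT p|lborel. U p) = E + d * (LINT p|lborel. \<phi> p * ln (f p)) + d\<^sup>2 / c * N"
      unfolding U_def E_def N_def using ent \<phi>ln \<phi>int \<phi>0 by simp
    moreover have "concordance F F = concordance f f + d * L + d\<^sup>2 * concordance \<phi> \<phi>"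
      unfolding F_def L_def by (rule concordance_perturb[OF int \<phi>int])
    ultimately show ?thesis by (simp add: algebra_simps)
  qed
  have "r * L - (LINT p|lborel. \<phi> p * ln (f p)) = 0"
    by (rule linear_coefficient_zero[OF _ key, of "min (c / 2) 1"]) (use bds in auto)
  moreover note var = concordance_first_variation[OF f h \<phi>int \<phi>(3), folded L_def]
  moreover have eq: "\<phi> p * (ln (f p) - r * (1 - fst p + snd p - 2 * h (fst p) (snd p)))
      = \<phi> p * ln (f p) - r * (\<phi> p * (1 - fst p + snd p - 2 * h (fst p) (snd p)))" for p
    by (simp add: algebra_simps)
  ultimately show "(LINT p|lborel. \<phi> p * (ln (f p) - r * (1 - fst p + snd p - 2 * h (fst p) (snd p)))) = 0"
    unfolding eq using \<phi>ln by (subst Bochner_Integration.integral_diff) auto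
  show "integrable lborel (\<lambda>p. \<phi> p * (ln (f p) - r * (1 - fst p + snd p - 2 * h (fst p) (snd p))))"
    unfolding eq using \<phi>ln var(1) by (intro Bochner_Integration.integrable_diff integrable_mult_right)
qed

section \<open>Finiteness of the maximal energy\<close>

lemma grid_cell_unique:
  fixes xs :: "nat \<Rightarrow> real"
  assumes xs: "strict_mono_on {0..k} xs" and u: "u \<in> {1..k}" "u' \<in> {1..k}"
    and x: "xs (u - 1) \<le> x" "x \<le> xs u" "xs (u' - 1) < x" "x < xs u'"
  shows "u = u'"
proof -
  have m: "xs a \<le> xs b" if "a \<le> b" "b \<le> k" for a b
    using strict_mono_onD[OF xs, of a b] that by (cases "a = b") auto
  have "\<not> u < u'" using m[of u "u' - 1"] u x by force
  moreover have "\<not> u' < u" using m[of u' "u - 1"] u x by force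
  ultimately show ?thesis by simp
qed

text \<open>
  The open cells miss only the finitely many grid points.
\<close>

lemma sum_measure_grid_cells:
  fixes xs :: "nat \<Rightarrow> real"
  assumes xs: "xs 0 = 0" "strict_mono_on {0..k} xs" and A: "A \<in> sets borel" and n: "n \<le> k"
  shows "(\<Sum>u=1..n. measure lborel ({xs (u - 1)<..<xs u} \<inter> A)) = measure lborel ({0..xs n} \<inter> A)"
  using n
proof (induction n)
  case 0
  have "measure lborel ({0..xs 0} \<inter> A) = measure lborel ({} :: real set)"
  proof (rule measure_eq_AE)
    show "AE x in lborel. (x \<in> {0..xs 0} \<inter> A) = (x \<in> {})"
      using AE_lborel_singleton[of "0 :: real"] by eventually_elim (use xs in auto)
  qed (use A in auto)
  then show ?case by simp
next
  case (Suc n)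
  have fin: "emeasure lborel (S \<inter> A) \<noteq> \<infinity>" if "S \<subseteq> {0..xs (Suc n)}" "S \<in> sets borel" for S
  proof -
    have "emeasure lborel (S \<inter> A) \<le> emeasure lborel {0..xs (Suc n)}"
      using that A by (intro emeasure_mono) auto
    also have "\<dots> < \<infinity>" using emeasure_lborel_cbox_finite[of 0 "xs (Suc n)"] by simp
    finally show ?thesis by simp
  qed
  have lt: "xs n < xs (Suc n)" using strict_mono_onD[OF xs(2), of n "Suc n"] Suc by simp
  have "0 \<le> xs n"
    using strict_mono_onD[OF xs(2), of 0 n] Suc xs(1) by (cases "n = 0") auto
  have "(\<Sum>u=1..Suc n. measure lborel ({xs (u - 1)<..<xs u} \<inter> A))
      = measure lborel ({0..xs n} \<inter> A) + measure lborel ({xs n<..<xs (Suc n)} \<inter> A)"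
    using Suc by simp
  also have "\<dots> = measure lborel (({0..xs n} \<inter> A) \<union> ({xs n<..<xs (Suc n)} \<inter> A))"
    using A lt \<open>0 \<le> xs n\<close> by (intro measure_Union[symmetric] fin) auto
  also have "\<dots> = measure lborel ({0..xs (Suc n)} \<inter> A)"
  proof (rule measure_eq_AE)
    show "AE x in lborel. (x \<in> {0..xs n} \<inter> A \<union> {xs n<..<xs (Suc n)} \<inter> A) = (x \<in> {0..xs (Suc n)} \<inter> A)"
      using AE_lborel_singleton[of "xs (Suc n)"] by eventually_elim (use lt \<open>0 \<le> xs n\<close> in auto)
  qed (use A in auto)
  finally show ?case .
qed

text \<open>
  Spread the mass \<open>B\<^sub>u\<^sub>v\<close> uniformly over the cell \<open>(u,v)\<close>. The row and column sums of \<open>B\<close> make the marginals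
  uniform, forbidden cells get no mass since \<open>B\<close> vanishes there, and a bounded density has finite entropy.
\<close>

lemma nondegenerate_imp_finite_energy:
  assumes xs: "xs 0 = 0" "xs k = 1" "strict_mono_on {0..k} xs"
    and ys: "ys 0 = 0" "ys l = 1" "strict_mono_on {0..l} ys"
    and nd: "nondegenerate k l xs ys I"
  obtains h where "h \<in> class_F_xyI k l xs ys I" "permuton_energy r h \<noteq> - \<infinity>"
proof -
  obtain B where B: "\<And>u v. u \<in> {1..k} \<Longrightarrow> v \<in> {1..l} \<Longrightarrow> 0 \<le> B u v \<and> (0 < B u v \<longleftrightarrow> I u v = 1)"
    and Bx: "\<And>u. u \<in> {1..k} \<Longrightarrow> (\<Sum>v=1..l. B u v) = xs u - xs (u - 1)"
    and By: "\<And>v. v \<in> {1..l} \<Longrightarrow> (\<Sum>u=1..k. B u v) = ys v - ys (v - 1)"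
    using nd unfolding nondegenerate_def by metis
  define X where "X u = {xs (u - 1)<..<xs u}" for u
  define Y where "Y v = {ys (v - 1)<..<ys v}" for v
  define c where "c u v = B u v / ((xs u - xs (u - 1)) * (ys v - ys (v - 1)))" for u v
  define f where "f p = (\<Sum>u=1..k. \<Sum>v=1..l. c u v * indicator (X u \<times> Y v) p)" for p
  note gx = grid_bounds[OF xs] and gy = grid_bounds[OF ys]
  have XY [measurable]: "X u \<in> sets borel" "Y v \<in> sets borel" "X u \<times> Y v \<in> sets borel" for u v
    by (auto simp: X_def Y_def borel_Times)
  have c0: "0 \<le> c u v" if "u \<in> {1..k}" "v \<in> {1..l}" for u v
    using B[OF that] gx[OF that(1)] gy[OF that(2)] by (auto simp: c_def)
  have sub: "X u \<times> Y v \<subseteq> unit_square" if "u \<in> {1..k}" "v \<in> {1..l}" for u v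
    using gx[OF that(1)] gy[OF that(2)] by (auto simp: X_def Y_def)
  have f_meas [measurable]: "f \<in> borel_measurable borel" unfolding f_def by measurable
  have f0: "0 \<le> f p" for p unfolding f_def using c0 by (intro sum_nonneg mult_nonneg_nonneg) auto
  have f_off: "f p = 0" if "p \<notin> unit_square" for p
    unfolding f_def using sub that by (intro sum.neutral ballI) (auto simp: indicator_def)
  define M where "M = (\<Sum>u=1..k. \<Sum>v=1..l. c u v)"
  have fM: "f p \<le> M" for p
    unfolding f_def M_def using c0 by (intro sum_mono) (auto simp: indicator_def)
  have f_int: "integrable lborel f"
    by (rule integrable_bounded_on_unit_square[OF f_meas _ f_off]) (use f0 fM in auto)
  have fS: "(LINT p|lborel. f p * indicator S p) = (\<Sum>u=1..k. \<Sum>v=1..l. c u v * measure lborel ((X u \<times> Y v) \<inter> S))"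
    if [measurable]: "S \<in> sets borel" for S
  proof -
    have ii: "integrable lborel (\<lambda>p. c u v * indicator ((X u \<times> Y v) \<inter> S) p)" if "u \<in> {1..k}" "v \<in> {1..l}" for u v
      using sub[OF that]
      by (intro integrable_mult_right integrable_bounded_on_unit_square[where M = 1]) (auto simp: indicator_def)
    have "(LINT p|lborel. f p * indicator S p)
       = (LINT p|lborel. (\<Sum>u=1..k. \<Sum>v=1..l. c u v * indicator ((X u \<times> Y v) \<inter> S) p))"
      unfolding f_def sum_distrib_right
      by (intro Bochner_Integration.integral_cong sum.cong refl) (auto simp: indicator_def)
    also have "\<dots> = (\<Sum>u=1..k. \<Sum>v=1..l. (LINT p|lborel. c u v * indicator ((X u \<times> Y v) \<inter> S) p))"
    proof -
      have "(LINT p|lborel. (\<Sum>u=1..k. \<Sum>v=1..l. c u v * indicator ((X u \<times> Y v) \<inter> S) p))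
          = (\<Sum>u=1..k. LINT p|lborel. (\<Sum>v=1..l. c u v * indicator ((X u \<times> Y v) \<inter> S) p))"
        by (rule Bochner_Integration.integral_sum) (intro Bochner_Integration.integrable_sum ii)
      also have "\<dots> = (\<Sum>u=1..k. \<Sum>v=1..l. (LINT p|lborel. c u v * indicator ((X u \<times> Y v) \<inter> S) p))"
        by (rule sum.cong[OF refl], rule Bochner_Integration.integral_sum, rule ii)
      finally show ?thesis .
    qed
    finally show ?thesis by simp
  qed
  have mX: "measure lborel (X u) = xs u - xs (u - 1)" if "u \<in> {1..k}" for u using gx[OF that] by (simp add: X_def)
  have mY: "measure lborel (Y v) = ys v - ys (v - 1)" if "v \<in> {1..l}" for v using gy[OF that] by (simp add: Y_def)
  have "permuton_pdf (density lborel (\<lambda>p. ennreal (f p))) f"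
  proof (rule permuton_pdfI[OF f_meas f0 f_off f_int])
    fix A :: "real set" assume A: "A \<in> sets borel"
    have "(LINT p|lborel. f p * indicator (A \<times> UNIV) p)
        = (\<Sum>u=1..k. \<Sum>v=1..l. c u v * (measure lborel (X u \<inter> A) * measure lborel (Y v)))"
      using A by (simp add: fS borel_Times Times_Int_Times measure_lborel_Times)
    also have "\<dots> = (\<Sum>u=1..k. measure lborel (X u \<inter> A))"
    proof (rule sum.cong[OF refl])
      fix u assume u: "u \<in> {1..k}"
      have "(\<Sum>v=1..l. c u v * (measure lborel (X u \<inter> A) * measure lborel (Y v)))
          = (\<Sum>v=1..l. measure lborel (X u \<inter> A) / (xs u - xs (u - 1)) * B u v)"
      proof (rule sum.cong[OF refl])
        fix v assume v: "v \<in> {1..l}"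
        have "xs u - xs (u - 1) \<noteq> 0" "ys v - ys (v - 1) \<noteq> 0" using gx[OF u] gy[OF v] by simp_all
        then show "c u v * (measure lborel (X u \<inter> A) * measure lborel (Y v)) = measure lborel (X u \<inter> A) / (xs u - xs (u - 1)) * B u v"
          unfolding c_def mY[OF v] by simp
      qed
      also have "\<dots> = measure lborel (X u \<inter> A)"
        unfolding sum_distrib_left[symmetric] Bx[OF u] using gx[OF u] by simp
      finally show "(\<Sum>v=1..l. c u v * (measure lborel (X u \<inter> A) * measure lborel (Y v))) = measure lborel (X u \<inter> A)" .
    qed
    also have "\<dots> = measure lborel (A \<inter> {0..1})"
      using sum_measure_grid_cells[OF xs(1,3) A order_refl] xs(2) by (simp add: X_def Int_commute)
    finally show "(LINT p|lborel. f p * indicator (A \<times> UNIV) p) = measure lborel (A \<inter> {0..1})" .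
  next
    fix A :: "real set" assume A: "A \<in> sets borel"
    have "(LINT p|lborel. f p * indicator (UNIV \<times> A) p)
        = (\<Sum>u=1..k. \<Sum>v=1..l. c u v * (measure lborel (X u) * measure lborel (Y v \<inter> A)))"
      using A by (simp add: fS borel_Times Times_Int_Times measure_lborel_Times)
    also have "\<dots> = (\<Sum>v=1..l. \<Sum>u=1..k. c u v * (measure lborel (X u) * measure lborel (Y v \<inter> A)))"
      by (rule sum.swap)
    also have "\<dots> = (\<Sum>v=1..l. measure lborel (Y v \<inter> A))"
    proof (rule sum.cong[OF refl])
      fix v assume v: "v \<in> {1..l}"
      have "(\<Sum>u=1..k. c u v * (measure lborel (X u) * measure lborel (Y v \<inter> A)))
          = (\<Sum>u=1..k. measure lborel (Y v \<inter> A) / (ys v - ys (v - 1)) * B u v)"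
      proof (rule sum.cong[OF refl])
        fix u assume u: "u \<in> {1..k}"
        have "xs u - xs (u - 1) \<noteq> 0" "ys v - ys (v - 1) \<noteq> 0" using gx[OF u] gy[OF v] by simp_all
        then show "c u v * (measure lborel (X u) * measure lborel (Y v \<inter> A)) = measure lborel (Y v \<inter> A) / (ys v - ys (v - 1)) * B u v"
          unfolding c_def mX[OF u] by simp
      qed
      also have "\<dots> = measure lborel (Y v \<inter> A)"
        unfolding sum_distrib_left[symmetric] By[OF v] using gy[OF v] by simp
      finally show "(\<Sum>u=1..k. c u v * (measure lborel (X u) * measure lborel (Y v \<inter> A))) = measure lborel (Y v \<inter> A)" .
    qed
    also have "\<dots> = measure lborel (A \<inter> {0..1})"
      using sum_measure_grid_cells[OF ys(1,3) A order_refl] ys(2) by (simp add: Y_def Int_commute)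
    finally show "(LINT p|lborel. f p * indicator (UNIV \<times> A) p) = measure lborel (A \<inter> {0..1})" .
  qed
  then obtain \<nu> where \<nu>: "permuton_pdf \<nu> f" by blast
  define h where "h = (\<lambda>x y. measure \<nu> ({x..1} \<times> {0..y}))"
  have h: "permuton_of h \<nu>" "h \<in> class_F"
    unfolding h_def using permuton_pdfD(1)[OF \<nu>] by (simp_all add: permuton_of_canonical permuton_in_class_F)
  have "h \<in> class_F_xyI k l xs ys I"
    unfolding class_F_xyI_iff_forbidden_mass[OF \<nu> h xs ys]
  proof (intro ballI impI)
    fix u v assume uv: "u \<in> {1..k}" "v \<in> {1..l}" and I0: "I u v = 0"
    have z: "f p * indicator ({xs (u - 1)..xs u} \<times> {ys (v - 1)..ys v}) p = 0" for p
    proof (cases "p \<in> {xs (u - 1)..xs u} \<times> {ys (v - 1)..ys v}")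
      case True
      have "c u' v' * indicator (X u' \<times> Y v') p = 0" if "u' \<in> {1..k}" "v' \<in> {1..l}" for u' v'
      proof (cases "p \<in> X u' \<times> Y v'")
        case inX: True
        from True have q: "xs (u - 1) \<le> fst p" "fst p \<le> xs u" "ys (v - 1) \<le> snd p" "snd p \<le> ys v"
          by (simp_all add: mem_Times_iff)
        from inX have q': "xs (u' - 1) < fst p" "fst p < xs u'" "ys (v' - 1) < snd p" "snd p < ys v'"
          by (simp_all add: mem_Times_iff X_def Y_def)
        have "u = u'" by (rule grid_cell_unique[OF xs(3) uv(1) that(1) q(1,2) q'(1,2)])
        moreover have "v = v'" by (rule grid_cell_unique[OF ys(3) uv(2) that(2) q(3,4) q'(3,4)])
        ultimately
        have "B u' v' = 0" using B[OF uv] I0 by simp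
        then show ?thesis by (simp add: c_def)
      qed simp
      then have "f p = 0" unfolding f_def by (intro sum.neutral ballI)
      then show ?thesis by simp
    qed simp
    show "(LINT p|lborel. f p * indicator ({xs (u - 1)..xs u} \<times> {ys (v - 1)..ys v}) p) = 0"
      by (simp only: z Bochner_Integration.integral_zero)
  qed
  moreover have "integrable lborel (\<lambda>p. f p * ln (f p))"
  proof (rule integrable_bounded_on_unit_square)
    fix p
    have "\<bar>f p * ln (f p)\<bar> \<le> (f p)\<^sup>2 + 1" by (rule abs_xlnx_le[OF f0])
    also have "\<dots> \<le> M\<^sup>2 + 1" using fM f0 by (simp add: power_mono)
    finally show "\<bar>f p * ln (f p)\<bar> \<le> M\<^sup>2 + 1" .
  qed (use f_off in simp_all)
  ultimately show thesis
    using that permuton_energy_eq_concordance[OF \<nu> h(1)] by auto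
qed

lemma maximizer_has_finite_entropy:
  assumes xs: "xs 0 = 0" "xs k = 1" "strict_mono_on {0..k} xs"
    and ys: "ys 0 = 0" "ys l = 1" "strict_mono_on {0..l} ys"
    and nd: "nondegenerate k l xs ys I"
    and max: "is_arg_max (permuton_energy r) (\<lambda>h'. h' \<in> class_F_xyI k l xs ys I) h"
    and h: "permuton_of h \<mu>"
  shows "absolutely_continuous lborel \<mu>"
    and "permuton_pdf \<mu> f \<Longrightarrow> integrable lborel (\<lambda>p. f p * ln (f p))"
proof -
  obtain h' where h': "h' \<in> class_F_xyI k l xs ys I" "permuton_energy r h' \<noteq> - \<infinity>"
    by (rule nondegenerate_imp_finite_energy[OF xs ys nd, where r = r])
  have "permuton_energy r h' \<le> permuton_energy r h"
    using max h'(1) by (auto simp: is_arg_max_def not_less)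
  then have fin: "permuton_energy r h \<noteq> - \<infinity>" using h'(2) by auto
  then obtain \<mu>' where "permuton_of h \<mu>'" "absolutely_continuous lborel \<mu>'"
    unfolding permuton_energy_def by (auto split: if_splits)
  then show "absolutely_continuous lborel \<mu>" using permuton_of_unique[OF h] by blast
  show "integrable lborel (\<lambda>p. f p * ln (f p))" if "permuton_pdf \<mu> f"
    using fin permuton_energy_eq_concordance[OF that h, of r] by (auto split: if_splits)
qed

section \<open>Localization at the corners\<close>

lemma class_F_isCont:
  assumes h: "h \<in> class_F" and a: "0 < a" "a < 1" "0 < b" "b < 1"
  shows "isCont (\<lambda>p. h (fst p) (snd p)) (a, b)"
proof -
  have lx: "\<bar>h x y - h x' y\<bar> \<le> \<bar>x - x'\<bar>" if "x \<in> {0..1}" "x' \<in> {0..1}" "y \<in> {0..1}" for x x' y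
  proof -
    have "\<forall>y\<in>{0..1}. 1-lipschitz_on {0..1} (\<lambda>x. h x y)" using h by (simp add: class_F_def)
    then have "1-lipschitz_on {0..1} (\<lambda>x. h x y)" using that(3) by (rule bspec)
    from lipschitz_onD[OF this that(1,2)] show ?thesis by (simp add: dist_real_def)
  qed
  have ly: "\<bar>h x y - h x y'\<bar> \<le> \<bar>y - y'\<bar>" if "y \<in> {0..1}" "y' \<in> {0..1}" "x \<in> {0..1}" for x y y'
  proof -
    have "\<forall>x\<in>{0..1}. 1-lipschitz_on {0..1} (\<lambda>y. h x y)" using h by (simp add: class_F_def)
    then have "1-lipschitz_on {0..1} (\<lambda>y. h x y)" using that(3) by (rule bspec)
    from lipschitz_onD[OF this that(1,2)] show ?thesis by (simp add: dist_real_def)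
  qed
  have "\<forall>\<^sub>F p in at (a, b). p \<in> unit_square"
    using a by (intro eventually_at_in_open' open_Times) auto
  then have "\<forall>\<^sub>F p in at (a, b). norm (h (fst p) (snd p) - h a b) \<le> \<bar>fst p - a\<bar> + \<bar>snd p - b\<bar>"
  proof eventually_elim
    case (elim p)
    then show ?case using lx[of "fst p" a "snd p"] ly[of "snd p" b a] a by (auto simp: mem_Times_iff)
  qed
  then have "((\<lambda>p. h (fst p) (snd p) - h a b) \<longlongrightarrow> 0) (at (a, b))"
  proof (rule Lim_null_comparison)
    have "((\<lambda>p. \<bar>fst p - a\<bar> + \<bar>snd p - b\<bar>) \<longlongrightarrow> \<bar>fst (a, b) - a\<bar> + \<bar>snd (a, b) - b\<bar>) (at (a, b))"
    by (intro tendsto_add tendsto_rabs tendsto_diff tendsto_fst tendsto_snd tendsto_const tendsto_ident_at)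
    then show "((\<lambda>p. \<bar>fst p - a\<bar> + \<bar>snd p - b\<bar>) \<longlongrightarrow> 0) (at (a, b))" by simp
  qed
  then show ?thesis unfolding isCont_def by (simp add: LIM_zero_iff)
qed

lemma eventually_small_square:
  fixes x y :: real
  assumes "\<forall>\<^sub>F p in nhds (x, y). P p"
  shows "\<forall>\<^sub>F e in at_right (0::real). \<forall>p \<in> {x..x + e} \<times> {y..y + e}. P p"
proof -
  obtain d where d: "0 < d" "\<And>p. dist p (x, y) < d \<Longrightarrow> P p"
    using assms unfolding eventually_nhds_metric by blast
  have "P p" if e: "0 < e" "e < d / 2" and p: "p \<in> {x..x + e} \<times> {y..y + e}" for e p
  proof (rule d(2))
    have "dist p (x, y) = sqrt ((dist (fst p) x)\<^sup>2 + (dist (snd p) y)\<^sup>2)"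
      by (simp add: dist_prod_def)
    also have "\<dots> \<le> dist (fst p) x + dist (snd p) y" by (rule sqrt_sum_squares_le_sum) auto
    also have "\<dots> < d" using e p by (auto simp: dist_real_def mem_Times_iff)
    finally show "dist p (x, y) < d" .
  qed
  then show ?thesis using d(1) unfolding eventually_at_right_field
    by (intro exI[of _ "d / 2"]) auto
qed

lemma eventually_strictly_inside:
  assumes "strictly_inside k l xs ys I x y"
  shows "\<forall>\<^sub>F p in nhds (x, y). strictly_inside k l xs ys I (fst p) (snd p)"
proof -
  obtain u v where uv: "u \<in> {1..k}" "v \<in> {1..l}" "I u v = 1"
     "xs (u - 1) < x" "x < xs u" "ys (v - 1) < y" "y < ys v"
    using assms by (auto simp: strictly_inside_def)
  have "\<forall>\<^sub>F p in nhds (x, y). p \<in> ({0<..<1} \<inter> {xs (u - 1)<..<xs u}) \<times> ({0<..<1} \<inter> {ys (v - 1)<..<ys v})"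
    using assms uv by (intro eventually_nhds_in_open open_Times) (auto simp: strictly_inside_def)
  then show ?thesis
  proof eventually_elim
    case (elim p)
    then have p: "0 < fst p" "fst p < 1" "0 < snd p" "snd p < 1"
      "xs (u - 1) < fst p" "fst p < xs u" "ys (v - 1) < snd p" "snd p < ys v"
      by (simp_all add: mem_Times_iff)
    then show ?case unfolding strictly_inside_def using uv(1-3) by blast
  qed
qed

text \<open>
  \<open>g\<close> is a version of the density only up to a planar null set, so by Fubini almost every horizontal section
  of \<open>g\<close> is one of the section of \<open>f\<close>, and both Lebesgue integrals may be replaced by Borel ones.
\<close>

lemma iterated_integral_eq_permuton_measure:
  assumes f: "permuton_pdf \<mu> f" and g: "AE p in lborel. p \<in> unit_square \<longrightarrow> g p = f p"
    and x: "0 < x1" "x2 < 1" and y: "0 < y1" "y2 < 1"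
  shows "(LINT y:{y1..y2}|lebesgue. (LINT x:{x1..x2}|lebesgue. g (x, y))) = measure \<mu> ({x1..x2} \<times> {y1..y2})"
proof -
  have [measurable]: "f \<in> borel_measurable borel" by (rule permuton_pdfD(2)[OF f])
  have i: "integrable (lborel \<Otimes>\<^sub>M lborel) (\<lambda>(x, y). f (x, y) * indicator ({x1..x2} \<times> {y1..y2}) (x, y))"
    using integrable_mult_indicator_real[OF permuton_pdf_integrable[OF f], of "{x1..x2} \<times> {y1..y2}"]
    by (simp add: case_prod_beta' lborel_prod borel_Times)
  define G where "G y = (LINT x|lborel. f (x, y) * indicator ({x1..x2} \<times> {y1..y2}) (x, y))" for y
  have G: "integrable lborel G" "(LINT y|lborel. G y) = measure \<mu> ({x1..x2} \<times> {y1..y2})"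
    using lborel_pair.integrable_snd[OF i] lborel_pair.integral_snd[OF i]
      permuton_pdf_measure[OF f, of "{x1..x2} \<times> {y1..y2}"]
    by (simp_all add: G_def[abs_def] lborel_prod case_prod_beta' borel_Times)
  have "AE p in lborel \<Otimes>\<^sub>M lborel. (case p of (y, x) \<Rightarrow> (x, y)) \<in> unit_square \<longrightarrow>
          g (case p of (y, x) \<Rightarrow> (x, y)) = f (case p of (y, x) \<Rightarrow> (x, y))"
  proof (rule AE_distrD[OF measurable_pair_swap'])
    have "distr (lborel \<Otimes>\<^sub>M lborel) (lborel \<Otimes>\<^sub>M lborel) (\<lambda>(y, x). (x, y)) = (lborel \<Otimes>\<^sub>M lborel :: (real \<times> real) measure)"
      by (rule lborel_pair.distr_pair_swap[symmetric])
    then show "AE p in distr (lborel \<Otimes>\<^sub>M lborel) (lborel \<Otimes>\<^sub>M lborel) (\<lambda>(y, x). (x, y)). p \<in> unit_square \<longrightarrow> g p = f p"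
      using g by (simp only: lborel_prod)
  qed
  from lborel_pair.AE_pair[OF this]
  have "AE y in lborel. AE x in lborel. (x, y) \<in> unit_square \<longrightarrow> g (x, y) = f (x, y)" by simp
  then have "AE y in lborel. indicator {y1..y2} y *\<^sub>R (LINT x:{x1..x2}|lebesgue. g (x, y)) = G y"
  proof eventually_elim
    case (elim y)
    show ?case
    proof (cases "y \<in> {y1..y2}")
      case True
      have "(LINT x:{x1..x2}|lebesgue. g (x, y)) = G y"
        unfolding set_lebesgue_integral_def G_def
      proof (rule integral_lebesgue_eq_lborel)
        show "AE xa in lborel. indicator {x1..x2} xa *\<^sub>R g (xa, y)
            = f (xa, y) * indicator ({x1..x2} \<times> {y1..y2}) (xa, y)"
          using elim by eventually_elim (use True x assms in \<open>auto simp: indicator_def\<close>)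
      qed (simp add: indicator_times)
      then show ?thesis using True by simp
    qed (simp add: G_def)
  qed
  then show ?thesis
    unfolding G(2)[symmetric] set_lebesgue_integral_def[of lebesgue "{y1..y2}"]
    using G(1) by (intro integral_lebesgue_eq_lborel) auto
qed

lemma integral_mult_indicator_rectangle:
  fixes X Y A B :: "real set"
  assumes "X \<in> sets borel" "Y \<in> sets borel" "A \<in> sets borel" "B \<in> sets borel"
  shows "(LINT p|lborel. indicat_real (X \<times> Y) p * indicator (A \<times> B) p)
    = measure lborel (X \<inter> A) * measure lborel (Y \<inter> B)"
proof -
  have "(LINT p|lborel. indicat_real (X \<times> Y) p * indicator (A \<times> B) p)
      = (LINT p|lborel. indicat_real ((X \<inter> A) \<times> (Y \<inter> B)) p)"
    by (rule Bochner_Integration.integral_cong) (auto simp: indicator_def)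
  also have "\<dots> = measure lborel ((X \<inter> A) \<times> (Y \<inter> B))"
    by simp
  finally show ?thesis using assms by (simp add: measure_lborel_Times)
qed

text \<open>
  A product \<open>\<alpha>(x) \<beta>(y)\<close> of two differences of indicators: if the intervals have equal lengths, both factors
  integrate to \<open>0\<close>, so both marginals vanish.
\<close>

definition alternating_boxes :: "real set \<Rightarrow> real set \<Rightarrow> real set \<Rightarrow> real set \<Rightarrow> real \<times> real \<Rightarrow> real" where
  "alternating_boxes A1 A2 B1 B2 p = (indicator A1 (fst p) - indicator A2 (fst p)) * (indicator B1 (snd p) - indicator B2 (snd p))"

lemma alternating_boxes_eq:
  "alternating_boxes A1 A2 B1 B2 p = indicator (A1 \<times> B1) p + indicator (A2 \<times> B2) p
     - indicator (A1 \<times> B2) p - indicator (A2 \<times> B1) p"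
  by (cases p) (simp add: alternating_boxes_def indicator_times algebra_simps)

text \<open>
  The coefficients are kept free, because besides \<open>alternating_boxes\<close> also its absolute value and its product with
  a step function taking one value per box are of this form.
\<close>

lemma integral_four_indicators:
  fixes a b c d :: real and A1 A2 B1 B2 S T :: "real set"
  assumes sets: "A1 \<in> sets borel" "A2 \<in> sets borel" "B1 \<in> sets borel" "B2 \<in> sets borel"
    "S \<in> sets borel" "T \<in> sets borel"
    and sub: "A1 \<subseteq> {0<..<1}" "A2 \<subseteq> {0<..<1}" "B1 \<subseteq> {0<..<1}" "B2 \<subseteq> {0<..<1}"
  defines "w \<equiv> \<lambda>p. a * indicator (A1 \<times> B1) p + b * indicator (A2 \<times> B2) p
     + c * indicator (A1 \<times> B2) p + d * indicator (A2 \<times> B1) p"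
  shows "integrable lborel (\<lambda>p. w p * indicator (S \<times> T) p)"
    and "(LINT p|lborel. w p * indicator (S \<times> T) p)
       = a * (measure lborel (A1 \<inter> S) * measure lborel (B1 \<inter> T)) + b * (measure lborel (A2 \<inter> S) * measure lborel (B2 \<inter> T))
        + c * (measure lborel (A1 \<inter> S) * measure lborel (B2 \<inter> T)) + d * (measure lborel (A2 \<inter> S) * measure lborel (B1 \<inter> T))"
proof -
  have i: "integrable lborel (\<lambda>p. e * (indicat_real (X \<times> Y) p * indicat_real (S \<times> T) p))"
    if "X \<in> {A1, A2}" "Y \<in> {B1, B2}" for X Y e
  proof -
    have [measurable]: "X \<times> Y \<in> sets borel" "S \<times> T \<in> sets borel" using that sets by (auto simp: borel_Times)
    have "X \<times> Y \<subseteq> unit_square" using that sub by auto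
    then have "integrable lborel (\<lambda>p. indicator (X \<times> Y) p * indicator (S \<times> T) p :: real)"
      by (intro integrable_bounded_on_unit_square[where M = 1]) (auto simp: indicator_def)
    then show ?thesis by (rule integrable_mult_right)
  qed
  have eq: "w p * indicator (S \<times> T) p = a * (indicator (A1 \<times> B1) p * indicator (S \<times> T) p)
     + b * (indicator (A2 \<times> B2) p * indicator (S \<times> T) p)
     + c * (indicator (A1 \<times> B2) p * indicator (S \<times> T) p) + d * (indicator (A2 \<times> B1) p * indicator (S \<times> T) p)" for p
    by (simp add: w_def distrib_right mult.assoc)
  show "integrable lborel (\<lambda>p. w p * indicator (S \<times> T) p)"
    unfolding eq by (intro Bochner_Integration.integrable_add i) auto
  show "(LINT p|lborel. w p * indicator (S \<times> T) p)
       = a * (measure lborel (A1 \<inter> S) * measure lborel (B1 \<inter> T)) + b * (measure lborel (A2 \<inter> S) * measure lborel (B2 \<inter> T))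
        + c * (measure lborel (A1 \<inter> S) * measure lborel (B2 \<inter> T)) + d * (measure lborel (A2 \<inter> S) * measure lborel (B1 \<inter> T))"
    unfolding eq
    by (subst Bochner_Integration.integral_add, (intro Bochner_Integration.integrable_add i; simp),
        (intro i; simp))+ (simp add: integral_mult_indicator_rectangle sets)
qed

theorem proposition3p11:
  fixes k l :: nat
    and xs ys :: "nat \<Rightarrow> real"
    and I :: "nat \<Rightarrow> nat \<Rightarrow> nat"
    and r :: real
    and h :: "real \<Rightarrow> real \<Rightarrow> real"
    and \<mu> :: "(real \<times> real) measure"
    and g :: "real \<times> real \<Rightarrow> real"
    and x1 x2 y1 y2 :: real
  assumes "0 < k" and "0 < l"
    and "xs 0 = 0" and "xs k = 1" and "strict_mono_on {0..k} xs"
    and "ys 0 = 0" and "ys l = 1" and "strict_mono_on {0..l} ys"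
    and "\<forall>u\<in>{1..k}. \<forall>v\<in>{1..l}. I u v \<in> {0, 1}"
    and "nondegenerate k l xs ys I"
    and "is_arg_max (permuton_energy r) (\<lambda>h'. h' \<in> class_F_xyI k l xs ys I) h"
    and "permuton_of h \<mu>"
    and "AE p in lebesgue. p \<in> unit_square \<longrightarrow> g p = permuton_density \<mu> p"
    and "0 < x1" and "x1 < x2" and "x2 < 1"
    and "0 < y1" and "y1 < y2" and "y2 < 1"
    and "\<forall>x\<in>{x1, x2}. \<forall>y\<in>{y1, y2}.
           strictly_inside k l xs ys I x y \<and> isCont g (x, y) \<and> 0 < g (x, y)"
  shows "ln (g (x1, y1) * g (x2, y2) / (g (x1, y2) * g (x2, y1)))
         - 2 * r * (LINT y:{y1..y2}|lebesgue. (LINT x:{x1..x2}|lebesgue. g (x, y))) = 0"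
proof -
  note xs = assms(3-5) and ys = assms(6-8) and nd = assms(10) and max = assms(11) and h = assms(12)
    and x = assms(14-16) and y = assms(17-19)
  note corner = assms(20)
  have pm: "permuton \<mu>" using h by (simp add: permuton_of_def)
  have hF: "h \<in> class_F" using max by (simp add: is_arg_max_def class_F_xyI_def)
  define f0 where "f0 p = (if p \<in> unit_square then permuton_density \<mu> p else 0)" for p
  have f0: "permuton_pdf \<mu> f0"
    unfolding f0_def
    by (rule permuton_pdf_of_absolutely_continuous[OF pm maximizer_has_finite_entropy(1)[OF xs ys nd max h]])
  have "AE p in lborel. p \<in> unit_square \<longrightarrow> g p = permuton_density \<mu> p"
    using assms(13) by (simp add: AE_completion_iff)
  then have gf0: "AE p in lborel. p \<in> unit_square \<longrightarrow> g p = f0 p"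
    by eventually_elim (simp add: f0_def)
  define V where "V p = ln (g p) - r * (1 - fst p + snd p - 2 * h (fst p) (snd p))" for p
  define D where "D = V (x1, y1) + V (x2, y2) - V (x1, y2) - V (x2, y1)"
  \<comment> \<open>Common bounds for \<open>g\<close> near all corners: the least corner value is \<open>2 m\<close>, the greatest is \<open>C - 1\<close>.\<close>
  define m where "m = Min ((\<lambda>(x, y). g (x, y)) ` ({x1, x2} \<times> {y1, y2})) / 2"
  define C where "C = Max ((\<lambda>(x, y). g (x, y)) ` ({x1, x2} \<times> {y1, y2})) + 1"
  have m: "0 < m" using corner by (auto simp: m_def Min_gr_iff)
  have mC: "m < g (a, b)" "g (a, b) < C" if "a \<in> {x1, x2}" "b \<in> {y1, y2}" for a b
  proof -
    have mem: "g (a, b) \<in> (\<lambda>(x, y). g (x, y)) ` ({x1, x2} \<times> {y1, y2})" using that by force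
    have "2 * m \<le> g (a, b)" using Min_le[OF _ mem] by (simp add: m_def)
    then show "m < g (a, b)" using m by simp
    show "g (a, b) < C" using Max_ge[OF _ mem] by (simp add: C_def)
  qed
  have inside: "0 < a" "a < 1" "0 < b" "b < 1" if "a \<in> {x1, x2}" "b \<in> {y1, y2}" for a b
    using that x y by auto
  have small: "\<bar>D\<bar> \<le> 4 * \<eta>" if \<eta>: "0 < \<eta>" for \<eta>
  proof -
    define Q where "Q a b p \<longleftrightarrow> strictly_inside k l xs ys I (fst p) (snd p) \<and> m < g p \<and> g p < C \<and> \<bar>V p - V (a, b)\<bar> < \<eta>" for a b p
    have "\<forall>\<^sub>F e in at_right 0. \<forall>p \<in> {a..a + e} \<times> {b..b + e}. Q a b p"
      if ab: "a \<in> {x1, x2}" "b \<in> {y1, y2}" for a b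
    proof (rule eventually_small_square)
      have c: "strictly_inside k l xs ys I a b" "isCont g (a, b)" "0 < g (a, b)" using corner ab by blast+
      have gt: "(g \<longlongrightarrow> g (a, b)) (nhds (a, b))" using c(2) by (simp add: isCont_def tendsto_at_iff_tendsto_nhds)
      have "isCont V (a, b)" unfolding V_def
        using c(2,3) class_F_isCont[OF hF inside[OF ab]] by (intro continuous_intros) auto
      then have Vt: "(V \<longlongrightarrow> V (a, b)) (nhds (a, b))" by (simp add: isCont_def tendsto_at_iff_tendsto_nhds)
      show "\<forall>\<^sub>F p in nhds (a, b). Q a b p"
        using eventually_strictly_inside[OF c(1)] order_tendstoD(1)[OF gt mC(1)[OF ab]]
          order_tendstoD(2)[OF gt mC(2)[OF ab]] tendstoD[OF Vt \<eta>]
        by eventually_elim (simp add: Q_def dist_real_def)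
    qed
    then have "\<forall>\<^sub>F e in at_right 0. (\<forall>p \<in> {x1..x1 + e} \<times> {y1..y1 + e}. Q x1 y1 p)
      \<and> (\<forall>p \<in> {x2..x2 + e} \<times> {y2..y2 + e}. Q x2 y2 p) \<and> (\<forall>p \<in> {x1..x1 + e} \<times> {y2..y2 + e}. Q x1 y2 p)
      \<and> (\<forall>p \<in> {x2..x2 + e} \<times> {y1..y1 + e}. Q x2 y1 p)"
      by (intro eventually_conj) auto
    moreover have "\<forall>\<^sub>F e in at_right 0. 0 < e \<and> e < min (x2 - x1) (min (1 - x2) (min (y2 - y1) (1 - y2)))"
      using x y unfolding eventually_at_right_field
      by (intro exI[of _ "min (x2 - x1) (min (1 - x2) (min (y2 - y1) (1 - y2)))"]) auto
    ultimately obtain e where e: "0 < e" "e < x2 - x1" "e < 1 - x2" "e < y2 - y1" "e < 1 - y2"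
      and Q: "\<And>p. p \<in> {x1..x1 + e} \<times> {y1..y1 + e} \<Longrightarrow> Q x1 y1 p" "\<And>p. p \<in> {x2..x2 + e} \<times> {y2..y2 + e} \<Longrightarrow> Q x2 y2 p"
        "\<And>p. p \<in> {x1..x1 + e} \<times> {y2..y2 + e} \<Longrightarrow> Q x1 y2 p" "\<And>p. p \<in> {x2..x2 + e} \<times> {y1..y1 + e} \<Longrightarrow> Q x2 y1 p"
      using eventually_happens'[OF trivial_limit_at_right_real eventually_conj] by (smt (verit) min_less_iff_conj)
    define A1 A2 B1 B2 where AB: "A1 = {x1..x1 + e}" "A2 = {x2..x2 + e}" "B1 = {y1..y1 + e}" "B2 = {y2..y2 + e}"
    have ABs: "A1 \<in> sets borel" "A2 \<in> sets borel" "B1 \<in> sets borel" "B2 \<in> sets borel" by (simp_all add: AB)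
    have ABsub: "A1 \<subseteq> {0<..<1}" "A2 \<subseteq> {0<..<1}" "B1 \<subseteq> {0<..<1}" "B2 \<subseteq> {0<..<1}"
      using x y e by (auto simp: AB)
    have ABm: "measure lborel A1 = e" "measure lborel A2 = e" "measure lborel B1 = e" "measure lborel B2 = e"
      using e by (simp_all add: AB)
    have disj: "A1 \<inter> A2 = {}" "B1 \<inter> B2 = {}" using e by (auto simp: AB)
    define S where "S = (A1 \<union> A2) \<times> (B1 \<union> B2)"
    have Sb [measurable]: "S \<in> sets borel" unfolding S_def using ABs by (intro borel_Times) auto
    have SU: "S \<subseteq> unit_square" unfolding S_def using ABsub by blast
    have SQ: "strictly_inside k l xs ys I (fst p) (snd p)" "m < g p" "g p < C" if "p \<in> S" for p
    proof -
      from that obtain a b where "Q a b p" using Q unfolding S_def AB mem_Times_iff by blast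
      then show "strictly_inside k l xs ys I (fst p) (snd p)" "m < g p" "g p < C" by (simp_all add: Q_def)
    qed
    define \<phi> where "\<phi> = alternating_boxes A1 A2 B1 B2"
    have \<phi>4: "\<phi> p = 1 * indicator (A1 \<times> B1) p + 1 * indicator (A2 \<times> B2) p
       + (-1) * indicator (A1 \<times> B2) p + (-1) * indicator (A2 \<times> B1) p" for p
      by (simp add: \<phi>_def alternating_boxes_eq)
    have \<phi>_S: "p \<in> S" if "\<phi> p \<noteq> 0" for p
      using that unfolding \<phi>_def alternating_boxes_def S_def by (auto simp: indicator_def mem_Times_iff split: if_splits)
    have \<phi>_meas: "\<phi> \<in> borel_measurable borel"
    proof -
      have [measurable]: "A1 \<times> B1 \<in> sets borel" "A2 \<times> B2 \<in> sets borel" "A1 \<times> B2 \<in> sets borel" "A2 \<times> B1 \<in> sets borel"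
        using ABs by (auto intro: borel_Times)
      show ?thesis unfolding \<phi>4[abs_def] by measurable
    qed
    have \<phi>_le: "\<bar>\<phi> p\<bar> \<le> 1" for p
      unfolding \<phi>_def alternating_boxes_def by (auto simp: indicator_def abs_mult)
    have \<phi>_off: "\<phi> p = 0" if "p \<notin> unit_square" for p using \<phi>_S SU that by blast
    \<comment> \<open>On \<open>S\<close> the density equals \<open>g\<close> almost everywhere, so clamping it there to \<open>[m, C]\<close> changes it on a null set only
       and makes the bounds needed for the perturbation hold pointwise.\<close>
    define f where "f p = (if p \<in> S then max m (min C (f0 p)) else f0 p)" for p
    note f0D = permuton_pdfD[OF f0]
    have f: "permuton_pdf \<mu> f"
    proof (rule permuton_pdf_cong_AE[OF f0])
      show "AE p in lborel. f p = f0 p"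
        using gf0
      proof eventually_elim
        case (elim p)
        show ?case
        proof (cases "p \<in> S")
          case True
          then have "g p = f0 p" using elim SU by blast
          then show ?thesis using SQ(2,3)[OF True] by (simp add: f_def)
        qed (simp add: f_def)
      qed
      have [measurable]: "f0 \<in> borel_measurable borel" by (rule f0D(2))
      show "f \<in> borel_measurable borel" unfolding f_def[abs_def] by measurable
      show "0 \<le> f p" for p using m f0D(3)[of p] by (simp add: f_def le_max_iff_disj)
      show "f p = 0" if "p \<notin> unit_square" for p
        using that SU f0D(4)[OF that] by (auto simp: f_def)
    qed
    have gf: "AE p in lborel. p \<in> S \<longrightarrow> f p = g p"
      using gf0
    proof eventually_elim
      case (elim p)
      show ?case
      proof
        assume pS: "p \<in> S"
        then have "g p = f0 p" using elim SU by blast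
        then show "f p = g p" using SQ(2,3)[OF pS] pS by (simp add: f_def)
      qed
    qed
    have int4: "integrable lborel (\<lambda>p. \<phi> p * indicator (X \<times> Y) p)"
      "(LINT p|lborel. \<phi> p * indicator (X \<times> Y) p) =
        measure lborel (A1 \<inter> X) * measure lborel (B1 \<inter> Y) + measure lborel (A2 \<inter> X) * measure lborel (B2 \<inter> Y)
        - measure lborel (A1 \<inter> X) * measure lborel (B2 \<inter> Y) - measure lborel (A2 \<inter> X) * measure lborel (B1 \<inter> Y)"
      if "X \<in> sets borel" "Y \<in> sets borel" for X Y
      unfolding \<phi>4 using integral_four_indicators[OF ABs that ABsub, of 1 1 "-1" "-1"] by simp_all
    define Vf where "Vf p = ln (f p) - r * (1 - fst p + snd p - 2 * h (fst p) (snd p))" for p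
    have Vf: "integrable lborel (\<lambda>p. \<phi> p * Vf p)" "(LINT p|lborel. \<phi> p * Vf p) = 0"
    proof -
      have fb: "m \<le> f p \<and> f p \<le> max m C" if "\<phi> p \<noteq> 0" for p
        using \<phi>_S[OF that] by (auto simp: f_def)
      have m1: "(LINT p|lborel. \<phi> p * indicator (X \<times> UNIV) p) = 0" if "X \<in> sets borel" for X
        using int4(2)[OF that, of UNIV] by (simp add: ABm)
      have m2: "(LINT p|lborel. \<phi> p * indicator (UNIV \<times> X) p) = 0" if "X \<in> sets borel" for X
        using int4(2)[OF _ that, of UNIV] by (simp add: ABm)
      have forb: "(LINT p|lborel. \<phi> p * indicator ({xs (u - 1)..xs u} \<times> {ys (v - 1)..ys v}) p) = 0"
        if uv: "u \<in> {1..k}" "v \<in> {1..l}" "I u v = 0" for u v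
      proof -
        have z: "\<phi> p * indicator ({xs (u - 1)..xs u} \<times> {ys (v - 1)..ys v}) p = 0" for p
        proof (rule ccontr)
          assume "\<phi> p * indicator ({xs (u - 1)..xs u} \<times> {ys (v - 1)..ys v}) p \<noteq> 0"
          then have "p \<in> S" and q: "xs (u - 1) \<le> fst p" "fst p \<le> xs u" "ys (v - 1) \<le> snd p" "snd p \<le> ys v"
            using \<phi>_S by (auto simp: indicator_def mem_Times_iff split: if_splits)
          from SQ(1)[OF this(1)] obtain u' v' where u'v': "u' \<in> {1..k}" "v' \<in> {1..l}" "I u' v' = 1"
            "xs (u' - 1) < fst p" "fst p < xs u'" "ys (v' - 1) < snd p" "snd p < ys v'"
            unfolding strictly_inside_def by blast
          \<comment> \<open>\<open>p\<close> is interior to an admissible cell, and an open cell meets no other closed cell.\<close>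
          have "u = u'" by (rule grid_cell_unique[OF xs(3) uv(1) u'v'(1) q(1,2) u'v'(4,5)])
          moreover have "v = v'" by (rule grid_cell_unique[OF ys(3) uv(2) u'v'(2) q(3,4) u'v'(6,7)])
          ultimately show False using uv(3) u'v'(3) by simp
        qed
        show ?thesis by (simp only: z Bochner_Integration.integral_zero)
      qed
      show "integrable lborel (\<lambda>p. \<phi> p * Vf p)" "(LINT p|lborel. \<phi> p * Vf p) = 0"
        unfolding Vf_def
        by (rule first_order_condition[OF xs ys max h f maximizer_has_finite_entropy(2)[OF xs ys nd max h f]
              \<phi>_meas \<phi>_le \<phi>_off m fb m1 m2 forb]; assumption)+
    qed
    \<comment> \<open>\<open>T\<close> is \<open>\<phi>\<close> times the step function with the corner values of \<open>V\<close>; as \<open>\<phi> Vf\<close> integrates to \<open>0\<close>,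
       the deviation of \<open>V\<close> from its corner values bounds \<open>e\<^sup>2 D\<close>.\<close>
    define T where "T p = V (x1, y1) * indicator (A1 \<times> B1) p + V (x2, y2) * indicator (A2 \<times> B2) p
       + (- V (x1, y2)) * indicator (A1 \<times> B2) p + (- V (x2, y1)) * indicator (A2 \<times> B1) p" for p
    have T: "integrable lborel T" "(LINT p|lborel. T p) = e\<^sup>2 * D"
      using integral_four_indicators[OF ABs _ _ ABsub, of UNIV UNIV "V (x1, y1)" "V (x2, y2)" "- V (x1, y2)" "- V (x2, y1)"]
      by (simp_all add: T_def[abs_def] ABm D_def algebra_simps power2_eq_square)
    have R: "integrable lborel (\<lambda>p. \<eta> * \<bar>\<phi> p\<bar>)" "(LINT p|lborel. \<eta> * \<bar>\<phi> p\<bar>) = \<eta> * (4 * e\<^sup>2)"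
    proof -
      have "\<bar>\<phi> p\<bar> = 1 * indicator (A1 \<times> B1) p + 1 * indicator (A2 \<times> B2) p
       + 1 * indicator (A1 \<times> B2) p + 1 * indicator (A2 \<times> B1) p" for p
        using disj by (cases p) (auto simp: \<phi>_def alternating_boxes_def indicator_def)
      then show "integrable lborel (\<lambda>p. \<eta> * \<bar>\<phi> p\<bar>)" "(LINT p|lborel. \<eta> * \<bar>\<phi> p\<bar>) = \<eta> * (4 * e\<^sup>2)"
        using integral_four_indicators[OF ABs _ _ ABsub, of UNIV UNIV 1 1 1 1]
        by (simp_all add: ABm power2_eq_square)
    qed
    have bound: "AE p in lborel. norm (T p - \<phi> p * Vf p) \<le> \<eta> * \<bar>\<phi> p\<bar>"
      using gf
    proof eventually_elim
      case (elim p)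
      obtain s t where p: "p = (s, t)" by (cases p)
      have VV: "Vf p = V p" if "p \<in> S" using elim that by (simp add: Vf_def V_def)
      consider "p \<notin> S" | "s \<in> A1" "t \<in> B1" | "s \<in> A2" "t \<in> B2" | "s \<in> A1" "t \<in> B2" | "s \<in> A2" "t \<in> B1"
        unfolding S_def p by blast
      then show ?case
      proof cases
        case 1
        then have "\<phi> p = 0" using \<phi>_S by blast
        moreover have "T p = 0" using 1 by (cases p) (auto simp: T_def S_def indicator_def)
        ultimately show ?thesis by simp
      next
        case 2
        then have "p \<in> S" "T p = V (x1, y1)" "\<phi> p = 1" "Q x1 y1 p"
          using disj Q(1)[of p] by (auto simp: T_def S_def p \<phi>_def alternating_boxes_def AB[symmetric] indicator_def)
        then show ?thesis using VV by (simp add: Q_def abs_minus_commute)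
      next
        case 3
        then have "p \<in> S" "T p = V (x2, y2)" "\<phi> p = 1" "Q x2 y2 p"
          using disj Q(2)[of p] by (auto simp: T_def S_def p \<phi>_def alternating_boxes_def AB[symmetric] indicator_def)
        then show ?thesis using VV by (simp add: Q_def abs_minus_commute)
      next
        case 4
        then have "p \<in> S" "T p = - V (x1, y2)" "\<phi> p = - 1" "Q x1 y2 p"
          using disj Q(3)[of p] by (auto simp: T_def S_def p \<phi>_def alternating_boxes_def AB[symmetric] indicator_def)
        then show ?thesis using VV by (simp add: Q_def)
      next
        case 5
        then have "p \<in> S" "T p = - V (x2, y1)" "\<phi> p = - 1" "Q x2 y1 p"
          using disj Q(4)[of p] by (auto simp: T_def S_def p \<phi>_def alternating_boxes_def AB[symmetric] indicator_def)
        then show ?thesis using VV by (simp add: Q_def)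
      qed
    qed
    have TVf: "integrable lborel (\<lambda>p. T p - \<phi> p * Vf p)" using T(1) Vf(1) by simp
    have "norm (LINT p|lborel. T p - \<phi> p * Vf p) \<le> (LINT p|lborel. norm (T p - \<phi> p * Vf p))"
      by (rule integral_norm_bound)
    also have "\<dots> \<le> (LINT p|lborel. \<eta> * \<bar>\<phi> p\<bar>)"
      by (rule integral_mono_AE[OF integrable_norm[OF TVf] R(1) bound])
    finally have "norm (LINT p|lborel. T p - \<phi> p * Vf p) \<le> (LINT p|lborel. \<eta> * \<bar>\<phi> p\<bar>)" .
    moreover have "(LINT p|lborel. T p - \<phi> p * Vf p) = e\<^sup>2 * D"
      using T Vf by (subst Bochner_Integration.integral_diff) auto
    ultimately have "e\<^sup>2 * \<bar>D\<bar> \<le> e\<^sup>2 * (4 * \<eta>)"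
      unfolding R(2) by (simp add: abs_mult mult_ac)
    then show ?thesis using e(1) by (simp add: mult_le_cancel_left_pos)
  qed
  have "D = 0"
  proof (rule ccontr)
    assume "D \<noteq> 0"
    then show False using small[of "\<bar>D\<bar> / 8"] by simp
  qed
  have pos: "0 < g (x1, y1)" "0 < g (x2, y2)" "0 < g (x1, y2)" "0 < g (x2, y1)" using corner by auto
  have "h x1 y1 + h x2 y2 - h x1 y2 - h x2 y1 = - measure \<mu> ({x1..x2} \<times> {y1..y2})"
    using permuton_rectangle[OF pm, of x1 x2 y1 y2] x y h by (simp add: permuton_of_def)
  moreover have "D = ln (g (x1, y1) * g (x2, y2) / (g (x1, y2) * g (x2, y1)))
      + 2 * r * (h x1 y1 + h x2 y2 - h x1 y2 - h x2 y1)"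
    using pos by (simp add: D_def V_def ln_mult_pos ln_divide_pos algebra_simps)
  moreover have "(LINT y:{y1..y2}|lebesgue. (LINT x:{x1..x2}|lebesgue. g (x, y))) = measure \<mu> ({x1..x2} \<times> {y1..y2})"
    using x y by (intro iterated_integral_eq_permuton_measure[OF f0 gf0]) auto
  ultimately show ?thesis using \<open>D = 0\<close> by simp
qed

end
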